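(* For $m,b\in\mathbb{R}$, let $\ell_{m,b}\subset\mathbb{R}^2$ denote the line with equation $y=mx+b$. Let $d_v^*:=\log\big((9+\sqrt{105})/2\big)/\log 16$. (i) For each $f\in\mathcal{T}_c$ and each $m\in\mathbb{Z}$, $$\max_{b\in\mathbb{R}}\ \dim_H\big(\mathrm{Graph}(f)\cap \ell_{m,b}\big)=\frac12 .$$ (ii) For each $m\in\mathbb{Z}$, $$\max_{f\in\mathcal{T}_v}\ \max_{b\in\mathbb{R}}\ \dim_H\big(\mathrm{Graph}(f)\cap \ell_{m,b}\big)=d_v^* .$$
   Context: $\phi(x)=\operatorname{dist}(x,\mathbb{Z})$ is the distance from $x\in\mathbb{R}$ to the nearest integer. $\mathcal{T}_v$ is the class of all functions $f:[0,1]\to\mathbb{R}$ of the form $$f(x)=\sum_{n=0}^\infty\frac{\omega_n(x)}{2^n}\phi(2^n x),\qquad 0\le x\le 1,$$ where for each $n\ge 0$ the function $\omega_n$ takes values in $\{-1,1\}$ and is constant on each interval $[j/2^n,(j+1)/2^n)$, $j=0,1,\dots,2^n-1$ (the value $\omega_n(1)$ is immaterial since $\phi(2^n)=0$). $\mathcal{T}_c$ is the subclass of those $f\in\mathcal{T}_v$ for which each $\omega_n$ is constant on $[0,1]$. $\mathrm{Graph}(f)=\{(x,f(x)):0\le x\le 1\}$. $\dim_H$ denotes Hausdorff dimension (with the convention $\dim_H\emptyset=0$). *)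

theory Defs
  imports "HOL-Analysis.Analysis"
begin

section \<open>Hausdorff measure and dimension\<close>

text \<open>
  The case \<open>s = 0\<close> is separate because \<open>0 powr 0 = 0\<close> in HOL, whereas Hausdorff measure needs
  \<open>0\<^sup>0 = 1\<close> for nonempty sets (so that the 0-dimensional measure is counting measure).
\<close>
definition hausdorff_gauge :: "real \<Rightarrow> 'a::metric_space set \<Rightarrow> ennreal" where
  "hausdorff_gauge s U =
     (if U = {} then 0 else if s = 0 then 1 else ennreal (diameter U powr s))"

text \<open>
  Covering sets are required to be bounded since \<^const>\<open>diameter\<close> is only meaningful for bounded
  sets. Finite covers are included: pad the sequence with empty sets.
\<close>
definition hausdorff_pre_measure :: "real \<Rightarrow> real \<Rightarrow> 'a::metric_space set \<Rightarrow> ennreal" where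
  "hausdorff_pre_measure s \<delta> A =
     (INF U \<in> {U :: nat \<Rightarrow> 'a set. A \<subseteq> (\<Union>i. U i) \<and>
                                 (\<forall>i. bounded (U i) \<and> diameter (U i) \<le> \<delta>)}.
        \<Sum>i. hausdorff_gauge s (U i))"

definition hausdorff_measure :: "real \<Rightarrow> 'a::metric_space set \<Rightarrow> ennreal" where
  "hausdorff_measure s A = (SUP \<delta> \<in> {0<..}. hausdorff_pre_measure s \<delta> A)"

definition hausdorff_dim :: "'a::metric_space set \<Rightarrow> ereal" where
  "hausdorff_dim A = Inf (ereal ` {s. 0 \<le> s \<and> hausdorff_measure s A = 0})"

lemma hausdorff_dim_empty [simp]: "hausdorff_dim ({} :: 'a::metric_space set) = 0"
proof -
  have "hausdorff_pre_measure 0 \<delta> ({} :: 'a set) = 0" if "\<delta> > 0" for \<delta>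
  proof -
    have "hausdorff_pre_measure 0 \<delta> ({} :: 'a set) \<le> (\<Sum>i::nat. hausdorff_gauge 0 ({} :: 'a set))"
      unfolding hausdorff_pre_measure_def using that by (intro INF_lower) auto
    then show ?thesis by (simp add: hausdorff_gauge_def)
  qed
  then have "hausdorff_measure 0 ({} :: 'a set) = 0"
    unfolding hausdorff_measure_def by (intro antisym SUP_least) auto
  then have "hausdorff_dim ({} :: 'a set) \<le> 0"
    unfolding hausdorff_dim_def zero_ereal_def by (intro Inf_lower) auto
  moreover have "0 \<le> hausdorff_dim ({} :: 'a set)"
    unfolding hausdorff_dim_def by (intro Inf_greatest) auto
  ultimately show ?thesis by (rule antisym)
qed

section \<open>Generalized Takagi functions\<close>

definition phi :: "real \<Rightarrow> real" where
  "phi x = infdist x \<int>"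

definition admissible_signs :: "(nat \<Rightarrow> real \<Rightarrow> real) \<Rightarrow> bool" where
  "admissible_signs \<omega> \<longleftrightarrow>
     (\<forall>n. \<forall>x\<in>{0..1}. \<omega> n x \<in> {-1, 1}) \<and>
     (\<forall>n. \<forall>j<2^n. \<omega> n constant_on {real j / 2^n ..< (real j + 1) / 2^n})"

definition takagi_expansion :: "(nat \<Rightarrow> real \<Rightarrow> real) \<Rightarrow> (real \<Rightarrow> real) \<Rightarrow> bool" where
  "takagi_expansion \<omega> f \<longleftrightarrow>
     (\<forall>x\<in>{0..1}. (\<lambda>n. \<omega> n x / 2^n * phi (2^n * x)) sums f x)"

text \<open>
  Functions on \<open>[0,1]\<close> are represented by functions on \<^typ>\<open>real\<close> whose values outside \<open>[0,1]\<close>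
  are irrelevant.
\<close>
definition T_v :: "(real \<Rightarrow> real) set" where
  "T_v = {f. \<exists>\<omega>. admissible_signs \<omega> \<and> takagi_expansion \<omega> f}"

definition T_c :: "(real \<Rightarrow> real) set" where
  "T_c = {f. \<exists>\<omega>. admissible_signs \<omega> \<and> (\<forall>n. \<omega> n constant_on {0..1}) \<and> takagi_expansion \<omega> f}"

definition Graph :: "(real \<Rightarrow> real) \<Rightarrow> (real \<times> real) set" where
  "Graph f = {(x, f x) | x. 0 \<le> x \<and> x \<le> 1}"

definition line :: "real \<Rightarrow> real \<Rightarrow> (real \<times> real) set" where
  "line m b = {(x, y). y = m * x + b}"

definition d_v_star :: real where
  "d_v_star = ln ((9 + sqrt 105) / 2) / ln 16"

text \<open>\<open>is_max S v\<close>: the maximum of \<open>S\<close> exists (i.e. is attained) and equals \<open>v\<close>.\<close>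
definition is_max :: "'a::linorder set \<Rightarrow> 'a \<Rightarrow> bool" where
  "is_max S v \<longleftrightarrow> v \<in> S \<and> (\<forall>x\<in>S. x \<le> v)"

end

theory Submission
  imports Defs "HOL-Real_Asymp.Real_Asymp"
begin

text \<open>
  Over a dyadic interval of length \<open>2\<^sup>-\<^sup>n\<close> a function \<open>f\<close> of the class is, in the scale \<open>2\<^sup>n\<close>, an affine
  function with integer slope and integer end values plus another function of the class
  (\<open>dyadic_restriction\<close>). Intersecting such a piece with a line of integer slope is therefore a problem
  of the original kind, described by the relative slope and the relative height of the line, and
  halving an interval acts on these data by an explicit rule that depends only on one sign
  (\<open>crossings_split\<close>). The dimension is the exponential growth rate of the number of pieces that the
  line still meets: counting them bounds it from above (\<open>hausdorff_dim_le_covered\<close>), and weights that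
  are additive under halving bound it from below, by the mass distribution principle
  (\<open>dyadic_mass.hausdorff_dim_support_ge\<close>).

  For constant signs, a piece of level \<open>n\<close> that meets the line has one of polynomially many pairs of
  relative slope and end value, so everything depends on how many pieces share a pair. At every second
  level the parity of the end value tells the left half of a parent from the right half; hence this
  multiplicity doubles only at every other level and stays below a constant times \<open>2\<^sup>n\<^sup>/\<^sup>2\<close>
  (\<open>card_same_piece\<close>). Conversely, two halvings turn a flat piece into exactly two flat pieces at one
  common height, which yields a Cantor set of dimension \<open>1/2\<close> inside a level set
  (\<open>T_c_level_set_dim_ge\<close>).

  For variable signs the number of pieces is controlled by a weight \<open>weight\<close> of a piece: whatever the signs,
  two halvings multiply the total weight by at most \<open>\<nu> = 4 powr d_v_star\<close>, where
  \<open>\<nu>\<^sup>4 = 9 \<nu>\<^sup>2 + 6\<close> (\<open>weight_step\<close>). The bound is attained on the line of height \<open>2/17\<close>, whose relative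
  heights are periodic under halving, by always choosing the sign that bends the graph towards the
  line: only nine kinds of pieces matter up to symmetry, and their weights are exactly additive
  (\<open>share_step\<close>). Nonzero slopes are reduced to slope zero by passing to one half, which changes the
  slope by one.
\<close>

section \<open>Hausdorff dimension of subsets of the line\<close>


lemma hausdorff_measure_zeroD:
  assumes "hausdorff_measure s A = 0" "\<delta> > 0" "\<epsilon> > 0"
  obtains U :: "nat \<Rightarrow> 'a::metric_space set" where "A \<subseteq> (\<Union>i. U i)"
    "\<And>i. bounded (U i)" "\<And>i. diameter (U i) \<le> \<delta>" "(\<Sum>i. hausdorff_gauge s (U i)) < \<epsilon>"
proof -
  have "hausdorff_pre_measure s \<delta> A \<le> hausdorff_measure s A"
    unfolding hausdorff_measure_def using assms(2) by (intro SUP_upper) auto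
  then have "hausdorff_pre_measure s \<delta> A < \<epsilon>"
    using assms by simp
  then show ?thesis
    unfolding hausdorff_pre_measure_def INF_less_iff using that by blast
qed

lemma hausdorff_measure_zeroI:
  fixes A :: "'a::metric_space set"
  assumes "\<And>\<delta> \<epsilon>. \<delta> > 0 \<Longrightarrow> \<epsilon> > (0::real) \<Longrightarrow> \<exists>U :: nat \<Rightarrow> 'a set. A \<subseteq> (\<Union>i. U i) \<and>
    (\<forall>i. bounded (U i) \<and> diameter (U i) \<le> \<delta>) \<and> (\<Sum>i. hausdorff_gauge s (U i)) \<le> ennreal \<epsilon>"
  shows "hausdorff_measure s A = 0"
proof -
  have "hausdorff_pre_measure s \<delta> A \<le> 0" if \<delta>: "\<delta> > 0" for \<delta>
  proof (rule ennreal_le_epsilon)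
    fix e :: real assume "0 < e"
    obtain U :: "nat \<Rightarrow> 'a set" where "A \<subseteq> (\<Union>i. U i)" "\<forall>i. bounded (U i) \<and> diameter (U i) \<le> \<delta>"
      "(\<Sum>i. hausdorff_gauge s (U i)) \<le> ennreal e"
      using assms[OF \<delta> \<open>0 < e\<close>] by blast
    then show "hausdorff_pre_measure s \<delta> A \<le> 0 + ennreal e"
      unfolding hausdorff_pre_measure_def by (intro INF_lower2[of U]) auto
  qed
  then show ?thesis
    unfolding hausdorff_measure_def by (auto simp: SUP_eq_iff intro!: antisym SUP_least)
qed

text \<open>
  A cover of \<open>A\<close> is mapped to a cover of \<open>g ` A\<close> whose diameters grow by at most the factor \<open>L\<close>. Allowing
  \<open>C \<subseteq> g ` A\<close> makes monotonicity of the dimension a special case.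
\<close>

lemma hausdorff_dim_lipschitz_image:
  fixes g :: "'a::metric_space \<Rightarrow> 'b::metric_space"
  assumes sub: "C \<subseteq> g ` A" and L: "L > 0"
    and lip: "\<And>x y. x \<in> A \<Longrightarrow> y \<in> A \<Longrightarrow> dist (g x) (g y) \<le> L * dist x y"
  shows "hausdorff_dim C \<le> hausdorff_dim A"
proof -
  have "hausdorff_measure s C = 0" if s: "0 \<le> s" "hausdorff_measure s A = 0" for s
  proof (rule hausdorff_measure_zeroI)
    fix \<delta> \<epsilon> :: real assume "\<delta> > 0" "\<epsilon> > 0"
    have Ls: "L powr s > 0" using L by simp
    have "\<delta> / L > 0" "ennreal (\<epsilon> / L powr s) > 0"
      using L Ls \<open>\<delta> > 0\<close> \<open>\<epsilon> > 0\<close> by auto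
    then obtain U where U: "A \<subseteq> (\<Union>i. U i)" "\<And>i. bounded (U i)" "\<And>i. diameter (U i) \<le> \<delta> / L"
      "(\<Sum>i. hausdorff_gauge s (U i)) < ennreal (\<epsilon> / L powr s)"
      using hausdorff_measure_zeroD[OF s(2), of "\<delta> / L" "ennreal (\<epsilon> / L powr s)"] by metis
    define V where "V i = g ` (U i \<inter> A)" for i
    have dV: "dist x y \<le> L * diameter (U i)" if "x \<in> V i" "y \<in> V i" for x y i
    proof -
      obtain a b where ab: "a \<in> U i \<inter> A" "b \<in> U i \<inter> A" "x = g a" "y = g b"
        using \<open>x \<in> V i\<close> \<open>y \<in> V i\<close> by (auto simp: V_def)
      have "dist x y \<le> L * dist a b" using lip ab by auto
      also have "\<dots> \<le> L * diameter (U i)"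
        using L ab diameter_bounded_bound[OF U(2)] by (intro mult_left_mono) auto
      finally show ?thesis .
    qed
    have bV: "bounded (V i)" for i
      unfolding bounded_two_points using dV by blast
    have diamV: "diameter (V i) \<le> L * diameter (U i)" for i
      using dV L diameter_ge_0[OF U(2)] unfolding diameter_def[of "V i"]
      by (auto intro!: cSUP_least)
    have "C \<subseteq> (\<Union>i. V i)" using sub U(1) by (fastforce simp: V_def)
    moreover have "diameter (V i) \<le> \<delta>" for i
      using diamV[of i] U(3)[of i] L by (auto simp: field_simps intro: order_trans)
    moreover have "(\<Sum>i. hausdorff_gauge s (V i)) \<le> ennreal \<epsilon>"
    proof -
      have "hausdorff_gauge s (V i) \<le> ennreal (L powr s) * hausdorff_gauge s (U i)" for i
      proof (cases "V i = {} \<or> s = 0")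
        case True
        then show ?thesis using L by (auto simp: hausdorff_gauge_def V_def)
      next
        case False
        then have "U i \<noteq> {}" by (auto simp: V_def)
        have "diameter (V i) powr s \<le> (L * diameter (U i)) powr s"
          using s diamV diameter_ge_0[OF bV] by (intro powr_mono2) auto
        also have "\<dots> = L powr s * diameter (U i) powr s"
          using L diameter_ge_0[OF U(2)] by (simp add: powr_mult)
        finally show ?thesis using False \<open>U i \<noteq> {}\<close>
          by (simp add: hausdorff_gauge_def ennreal_mult'[symmetric])
      qed
      then have "(\<Sum>i. hausdorff_gauge s (V i)) \<le> (\<Sum>i. ennreal (L powr s) * hausdorff_gauge s (U i))"
        by (intro suminf_le) auto
      also have "\<dots> = ennreal (L powr s) * (\<Sum>i. hausdorff_gauge s (U i))"
        by simp
      also have "\<dots> \<le> ennreal (L powr s) * ennreal (\<epsilon> / L powr s)"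
        using U(4) by (intro mult_left_mono) auto
      also have "\<dots> = ennreal \<epsilon>"
        using Ls \<open>\<epsilon> > 0\<close> by (simp add: ennreal_mult'[symmetric])
      finally show ?thesis .
    qed
    ultimately show "\<exists>V. C \<subseteq> (\<Union>i. V i) \<and> (\<forall>i. bounded (V i) \<and> diameter (V i) \<le> \<delta>) \<and>
        (\<Sum>i. hausdorff_gauge s (V i)) \<le> ennreal \<epsilon>"
      using bV by blast
  qed
  then show ?thesis
    unfolding hausdorff_dim_def by (intro Inf_superset_mono image_mono) auto
qed

definition dyadic :: "nat \<Rightarrow> nat \<Rightarrow> real set" where
  "dyadic n j = {real j / 2^n .. (real j + 1) / 2^n}"

lemma dyadic_subset_parent: "dyadic (Suc n) j \<subseteq> dyadic n (j div 2)"
proof -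
  have "2 * (j div 2) \<le> j" "j + 1 \<le> 2 * (j div 2) + 2" by auto
  then have "2 * real (j div 2) \<le> real j" "real j + 1 \<le> 2 * real (j div 2) + 2"
    by linarith+
  then have "2 ^ n * (2 * real (j div 2)) \<le> 2 ^ n * real j"
    "2 ^ n * (real j + 1) \<le> 2 ^ n * (2 * real (j div 2) + 2)"
    by (auto intro!: mult_left_mono)
  then show ?thesis
    unfolding dyadic_def by (auto simp: field_simps)
qed

definition covered :: "nat \<Rightarrow> real \<Rightarrow> real set \<Rightarrow> bool" where
  "covered n c Z \<longleftrightarrow> (\<exists>J. finite J \<and> real (card J) \<le> c \<and> Z \<subseteq> (\<Union>j\<in>J. dyadic n j))"

text \<open>
  Since the gauge of a dyadic interval of level \<open>n\<close> is \<open>2 powr (- s * n)\<close>, the assumption supplies covers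
  of arbitrarily small \<open>s\<close>-dimensional mass; it is enough to have them for infinitely many \<open>n\<close>.
\<close>

lemma hausdorff_dim_le_covered:
  assumes d: "0 \<le> d"
    and cov: "\<And>s \<epsilon> N. s > d \<Longrightarrow> \<epsilon> > 0 \<Longrightarrow> \<exists>n\<ge>N. covered n (\<epsilon> * 2 powr (s * real n)) Z"
  shows "hausdorff_dim Z \<le> ereal d"
proof -
  have zero: "hausdorff_measure s Z = 0" if s: "s > d" for s
  proof (rule hausdorff_measure_zeroI)
    fix \<delta> \<epsilon> :: real assume "\<delta> > 0" "\<epsilon> > 0"
    obtain N where N: "(1/2)^N < \<delta>" using \<open>\<delta> > 0\<close> real_arch_pow_inv[of \<delta> "1/2"] by auto
    obtain n J where nJ: "n \<ge> N" "finite J" "real (card J) \<le> \<epsilon> * 2 powr (s * real n)"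
      "Z \<subseteq> (\<Union>j\<in>J. dyadic n j)"
      using cov[OF s \<open>\<epsilon> > 0\<close>, of N] unfolding covered_def by blast
    obtain h where h: "bij_betw h {..<card J} J"
      using nJ(2) by (metis atLeast0LessThan ex_bij_betw_nat_finite)
    define U where "U i = (if i < card J then dyadic n (h i) else {})" for i
    have diam: "diameter (dyadic n j) = (1/2)^n" for j
      unfolding dyadic_def by (simp add: diameter_closed_interval field_simps)
    have small: "(1/2::real)^n \<le> \<delta>"
      using N power_decreasing[OF nJ(1), of "1/2::real"] by linarith
    have s0: "s > 0" using s d by simp
    have half: "((1/2::real)^n) powr s = inverse (2 powr (s * real n))"
      by (simp add: powr_realpow[symmetric] powr_powr powr_minus powr_divide powr_one_eq_one mult.commute field_simps)
    have "(\<Sum>i. hausdorff_gauge s (U i)) = (\<Sum>i<card J. hausdorff_gauge s (U i))"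
      by (rule suminf_finite) (auto simp: U_def hausdorff_gauge_def)
    also have "\<dots> = (\<Sum>i<card J. ennreal (((1/2)^n) powr s))"
      using s0 by (intro sum.cong) (auto simp: U_def hausdorff_gauge_def diam, auto simp: dyadic_def divide_simps)
    also have "\<dots> = ennreal (real (card J) * ((1/2)^n) powr s)"
      by (simp add: ennreal_mult'' ennreal_of_nat_eq_real_of_nat)
    also have "\<dots> \<le> ennreal \<epsilon>"
      using nJ(3) unfolding half by (intro ennreal_leI) (auto simp: field_simps)
    finally have "(\<Sum>i. hausdorff_gauge s (U i)) \<le> ennreal \<epsilon>" .
    moreover have "Z \<subseteq> (\<Union>i. U i)"
    proof
      fix x assume "x \<in> Z"
      then obtain j where "j \<in> J" "x \<in> dyadic n j" using nJ(4) by blast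
      moreover obtain i where "i < card J" "h i = j"
        using h \<open>j \<in> J\<close> unfolding bij_betw_def by (metis imageE lessThan_iff)
      ultimately show "x \<in> (\<Union>i. U i)" by (auto simp: U_def)
    qed
    moreover have "bounded (U i) \<and> diameter (U i) \<le> \<delta>" for i
      using small \<open>\<delta> > 0\<close> by (auto simp: U_def diam) (auto simp: dyadic_def)
    ultimately show "\<exists>U. Z \<subseteq> (\<Union>i. U i) \<and> (\<forall>i. bounded (U i) \<and> diameter (U i) \<le> \<delta>) \<and>
        (\<Sum>i. hausdorff_gauge s (U i)) \<le> ennreal \<epsilon>" by blast
  qed
  show ?thesis
  proof (rule ereal_le_epsilon2)
    fix e :: real assume "0 < e"
    then show "hausdorff_dim Z \<le> ereal d + ereal e"
      unfolding hausdorff_dim_def using d zero[of "d + e"] by (auto intro!: Inf_lower)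
  qed
qed


lemma sum_nat_pairs:
  fixes f :: "nat \<Rightarrow> 'a::comm_monoid_add"
  shows "(\<Sum>j<2 * m. f j) = (\<Sum>j<m. f (2 * j) + f (2 * j + 1))"
  by (induction m) (auto simp: add_ac)

lemma sum_UN_le:
  fixes f :: "'b \<Rightarrow> real"
  assumes "finite I" "\<And>x. 0 \<le> f x" "\<And>i. i \<in> I \<Longrightarrow> finite (A i)"
  shows "(\<Sum>x\<in>(\<Union>i\<in>I. A i). f x) \<le> (\<Sum>i\<in>I. \<Sum>x\<in>A i. f x)"
  using assms(1,3)
proof (induction I rule: finite_induct)
  case (insert i I)
  have "(\<Sum>x\<in>(\<Union>i\<in>insert i I. A i). f x) \<le> (\<Sum>x\<in>A i. f x) + (\<Sum>x\<in>(\<Union>i\<in>I. A i). f x)"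
    using insert assms(2) by (simp add: sum_Un sum_nonneg)
  then show ?case using insert by fastforce
qed simp

text \<open>
  A mass distribution on the unit interval, given only by the masses \<open>M n j\<close> of the dyadic intervals
  \<open>dyadic n j\<close>. Finite additivity suffices: compactness replaces the countable additivity of a measure.
\<close>

locale dyadic_mass =
  fixes M :: "nat \<Rightarrow> nat \<Rightarrow> real"
  assumes nonneg: "0 \<le> M n j"
    and total: "M 0 0 = 1"
    and additive: "M n j = M (Suc n) (2 * j) + M (Suc n) (2 * j + 1)"
begin

definition support :: "real set" where
  "support = {x. \<forall>n. \<exists>j<2^n. M n j > 0 \<and> x \<in> dyadic n j}"

lemma supportE:
  assumes "x \<in> support"
  obtains j where "j < 2^n" "M n j > 0" "x \<in> dyadic n j"
proof -
  from assms have "\<exists>j<2^n. M n j > 0 \<and> x \<in> dyadic n j" unfolding support_def mem_Collect_eq by (rule spec)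
  then show ?thesis using that by blast
qed

lemma total_level: "(\<Sum>j<2^n. M n j) = 1"
proof (induction n)
  case (Suc n)
  have "(\<Sum>j<2^Suc n. M (Suc n) j) = (\<Sum>j<2^n. M n j)"
    unfolding power_Suc sum_nat_pairs additive[of n, symmetric] ..
  then show ?case using Suc by simp
qed (simp add: total)

lemma mass_descendants: "(\<Sum>j\<in>{a * 2^k..<(a + 1) * 2^k}. M (n + k) j) = M n a"
proof (induction k arbitrary: n a)
  case (Suc k)
  have "(\<Sum>j\<in>{a * 2^Suc k..<(a + 1) * 2^Suc k}. M (n + Suc k) j)
      = (\<Sum>j\<in>{(2 * a) * 2^k..<(2 * a + 1) * 2^k}. M (Suc n + k) j)
        + (\<Sum>j\<in>{(2 * a + 1) * 2^k..<(2 * a + 1 + 1) * 2^k}. M (Suc n + k) j)"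
    by (subst sum.atLeastLessThan_concat) (auto simp: algebra_simps)
  also have "\<dots> = M n a"
    unfolding Suc.IH additive[of n a] ..
  finally show ?case .
qed simp

lemma parent_pos:
  assumes "M (Suc n) j > 0"
  shows "M n (j div 2) > 0"
proof -
  have "M n (j div 2) = M (Suc n) (2 * (j div 2)) + M (Suc n) (2 * (j div 2) + 1)"
    by (rule additive)
  moreover have "j = 2 * (j div 2) \<or> j = 2 * (j div 2) + 1" by auto
  ultimately show ?thesis
    using assms nonneg[of "Suc n" "2 * (j div 2)"] nonneg[of "Suc n" "2 * (j div 2) + 1"]
    by (metis add_pos_nonneg add_nonneg_pos)
qed

text \<open>
  A ball of radius \<open>l\<close> meets at most four dyadic intervals of the level whose mesh is comparable to \<open>l\<close>,
  and these carry the mass of everything below them.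
\<close>

lemma ball_mass:
  assumes bound: "\<And>n j. M n j \<le> C * (1/2^n) powr s" and s: "0 < s" and l: "0 < l"
  obtains N where "\<And>n. n \<ge> N \<Longrightarrow>
    (\<Sum>j | j < 2^n \<and> \<bar>real j / 2^n - p\<bar> < l. M n j) \<le> 4 * C * 2 powr s * l powr s"
proof (cases "l \<ge> 1")
  case True
  have C: "1 \<le> C" using bound[of 0 0] total by simp
  have "(\<Sum>j | j < 2^n \<and> \<bar>real j / 2^n - p\<bar> < l. M n j) \<le> 4 * C * 2 powr s * l powr s" for n
  proof -
    have "(\<Sum>j | j < 2^n \<and> \<bar>real j / 2^n - p\<bar> < l. M n j) \<le> (\<Sum>j<2^n. M n j)"
      using nonneg by (intro sum_mono2) auto
    also have "\<dots> = 1" by (rule total_level)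
    also have "1 \<le> C * (2 powr s * l powr s)"
      using C True s by (intro mult_ge1_I ge_one_powr_ge_zero) auto
    also have "\<dots> \<le> 4 * C * 2 powr s * l powr s" using C by simp
    finally show ?thesis .
  qed
  then show ?thesis using that by blast
next
  case False
  have C: "1 \<le> C" using bound[of 0 0] total by simp
  have ex: "\<exists>m. 1 / 2^m \<le> l"
    using real_arch_pow_inv[OF l, of "1/2"] by (auto simp: power_divide intro: less_imp_le)
  define m where "m = (LEAST m. 1 / 2^m \<le> l)"
  have m: "1 / 2^m \<le> l" unfolding m_def using ex by (rule LeastI_ex)
  have "m \<noteq> 0" using m False by (metis div_by_1 power_0)
  then obtain k where k: "m = Suc k" using not0_implies_Suc by blast
  have lk: "l < 1 / 2^k"
    using not_less_Least[of k "\<lambda>m. 1 / 2^m \<le> l"] k unfolding m_def by auto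
  have lk2: "1 / 2^k \<le> 2 * l" using m k by (simp add: field_simps)
  have "(\<Sum>j | j < 2^n \<and> \<bar>real j / 2^n - p\<bar> < l. M n j) \<le> 4 * C * 2 powr s * l powr s"
    if n: "n \<ge> k" for n
  proof -
    define A where "A = {a::nat. \<bar>real a / 2^k - p\<bar> < 2 / 2^k}"
    have Aint: "int ` A \<subseteq> {\<lfloor>2^k * p\<rfloor> - 1 .. \<lfloor>2^k * p\<rfloor> + 2}"
    proof safe
      fix a assume "a \<in> A"
      then have "2^k * \<bar>real a / 2^k - p\<bar> < 2"
        unfolding A_def by (simp add: field_simps)
      moreover have "2^k * \<bar>real a / 2^k - p\<bar> = \<bar>2^k * (real a / 2^k - p)\<bar>" by (simp add: abs_mult)
      ultimately have "\<bar>real a - 2^k * p\<bar> < 2" by (simp add: right_diff_distrib)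
      then show "int a \<in> {\<lfloor>2^k * p\<rfloor> - 1 .. \<lfloor>2^k * p\<rfloor> + 2}" by simp linarith
    qed
    have finA: "finite A" using Aint by (meson finite_atLeastAtMost_int finite_subset finite_imageD inj_on_of_nat)
    have "card A = card (int ` A)" by (simp add: card_image)
    also have "\<dots> \<le> 4" using card_mono[OF _ Aint] by simp
    finally have cardA: "card A \<le> 4" .
    have sub: "{j. j < 2^n \<and> \<bar>real j / 2^n - p\<bar> < l} \<subseteq> (\<Union>a\<in>A. {a * 2^(n - k)..<(a + 1) * 2^(n - k)})"
    proof safe
      fix j :: nat assume j: "j < 2^n" "\<bar>real j / 2^n - p\<bar> < l"
      define a where "a = j div 2^(n - k)"
      have aj: "a * 2^(n - k) \<le> j" "j < (a + 1) * 2^(n - k)"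
        unfolding a_def by (auto simp: dividend_less_div_times mult.commute[of _ "2^(n-k)"])
          (metis add.commute div_mult_mod_eq mod_less_divisor mult.commute nat_add_left_cancel_less pos2 zero_less_power)
      have pw: "(2::real)^n = 2^k * 2^(n - k)" using n by (simp flip: power_add)
      have "real (a * 2^(n - k)) \<le> real j" "real j < real ((a + 1) * 2^(n - k))"
        using aj by (simp_all only: of_nat_le_iff of_nat_less_iff)
      then have "real a * 2^(n - k) \<le> real j" "real j < (real a + 1) * 2^(n - k)"
        by (simp_all add: algebra_simps)
      then have "real a / 2^k \<le> real j / 2^n" "real j / 2^n < real a / 2^k + 1 / 2^k"
        unfolding pw by (simp_all add: field_simps)
      then have "a \<in> A" using j lk unfolding A_def by auto
      then show "j \<in> (\<Union>a\<in>A. {a * 2^(n - k)..<(a + 1) * 2^(n - k)})" using aj by auto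
    qed
    have "(\<Sum>j | j < 2^n \<and> \<bar>real j / 2^n - p\<bar> < l. M n j)
        \<le> (\<Sum>j\<in>(\<Union>a\<in>A. {a * 2^(n - k)..<(a + 1) * 2^(n - k)}). M n j)"
      using sub finA nonneg by (intro sum_mono2) auto
    also have "\<dots> \<le> (\<Sum>a\<in>A. \<Sum>j\<in>{a * 2^(n - k)..<(a + 1) * 2^(n - k)}. M n j)"
      using finA nonneg by (intro sum_UN_le) auto
    also have "\<dots> = (\<Sum>a\<in>A. M k a)"
      using mass_descendants[where n=k and k="n - k"] n by simp
    also have "\<dots> \<le> real (card A) * (C * (1/2^k) powr s)"
      using bound by (intro sum_bounded_above) auto
    also have "\<dots> \<le> 4 * (C * (2 * l) powr s)"
      using cardA C lk2 s by (intro mult_mono powr_mono2) auto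
    also have "\<dots> = 4 * C * 2 powr s * l powr s"
      using l by (simp add: powr_mult)
    finally show ?thesis .
  qed
  then show ?thesis using that by blast
qed

text \<open>
  The mass distribution principle. If the \<open>t\<close>-dimensional measure vanished for some \<open>t < s\<close>, the support
  would have a cover with \<open>\<Sum>i. D i powr s\<close> as small as desired. Enlarging its sets to open balls and using
  compactness, finitely many balls cover all intervals of positive mass at some level. By \<open>ball_mass\<close>
  the total mass \<open>1\<close> is then bounded by a small number.
\<close>

theorem hausdorff_dim_support_ge:
  assumes bound: "\<And>n j. M n j \<le> C * (1/2^n) powr s" and s: "0 < s"
  shows "ereal s \<le> hausdorff_dim support"
proof -
  have "s \<le> t" if t: "0 \<le> t" "hausdorff_measure t support = 0" for t
  proof (rule ccontr)
    assume "\<not> s \<le> t"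
    then have ts: "t < s" by simp
    have C: "1 \<le> C" using bound[of 0 0] total by simp
    define B where "B = 4 * C * 2 powr s"
    have B: "B > 0" using C by (simp add: B_def)
    define \<epsilon> where "\<epsilon> = 1 / (4 * B)"
    have \<epsilon>: "\<epsilon> > 0" using B by (simp add: \<epsilon>_def)
    obtain U where U: "support \<subseteq> (\<Union>i. U i)" "\<And>i. bounded (U i)" "\<And>i. diameter (U i) \<le> 1"
      "(\<Sum>i. hausdorff_gauge t (U i)) < ennreal \<epsilon>"
      using hausdorff_measure_zeroD[OF t(2), of 1 "ennreal \<epsilon>"] \<epsilon> by auto
    define D where "D i = diameter (U i)" for i
    have D: "0 \<le> D i" "D i \<le> 1" for i
      using U(2,3) by (auto simp: D_def diameter_ge_0)
    \<comment> \<open>The radius is chosen so that its \<open>s\<close>-th power exceeds that of the diameter by a summable amount;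
      this also covers sets of diameter zero.\<close>
    define l where "l i = (D i powr s + \<epsilon> * (1/2)^Suc i) powr (1/s)" for i
    have lpow: "l i powr s = D i powr s + \<epsilon> * (1/2)^Suc i" for i
      using s \<epsilon> by (simp add: l_def powr_powr)
    have l: "D i < l i" for i
    proof -
      have "D i = (D i powr s) powr (1/s)"
        using s D(1)[of i] by (simp add: powr_powr)
      also have "\<dots> < l i"
        unfolding l_def using s \<epsilon> by (intro powr_less_mono2) auto
      finally show ?thesis .
    qed
    have l0: "0 < l i" for i using l D(1) by (meson le_less_trans)
    define p where "p i = (SOME x. x \<in> U i)" for i
    define V where "V i = (if U i = {} then {} else ball (p i) (l i))" for i
    have UV: "U i \<subseteq> V i" for i
    proof
      fix x assume x: "x \<in> U i"
      then have "p i \<in> U i" unfolding p_def by (rule someI)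
      then have "dist (p i) x \<le> D i"
        unfolding D_def using x U(2) by (intro diameter_bounded_bound)
      then show "x \<in> V i" using l[of i] x by (auto simp: V_def)
    qed
    have openV: "open (V i)" for i by (simp add: V_def)
    define K where "K n = (\<Union>j\<in>{j. j < 2^n \<and> M n j > 0}. dyadic n j)" for n
    have compK: "compact (K n)" for n
      unfolding K_def dyadic_def by (intro compact_UN) auto
    have KSuc: "K (Suc n) \<subseteq> K n" for n
    proof
      fix x assume "x \<in> K (Suc n)"
      then obtain j where j: "j < 2^Suc n" "M (Suc n) j > 0" "x \<in> dyadic (Suc n) j"
        by (auto simp: K_def)
      have "j div 2 < 2^n" using j(1) by auto
      moreover have "x \<in> dyadic n (j div 2)" using j(3) dyadic_subset_parent by blast
      ultimately show "x \<in> K n" using parent_pos[OF j(2)] by (auto simp: K_def)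
    qed
    have Kmono: "K n \<subseteq> K m" if "m \<le> n" for m n
      using lift_Suc_antimono_le[of K, OF KSuc that] .
    have K: "support = (\<Inter>n. K n)"
      by (auto simp: support_def K_def)
    obtain n where n: "K n - (\<Union>i. V i) = {}"
    proof (rule ccontr)
      assume "\<not> thesis"
      with that have "K n - (\<Union>i. V i) \<noteq> {}" for n by metis
      moreover have "compact (K n - (\<Union>i. V i))" for n
        using compK openV by (intro compact_diff open_UN) auto
      moreover have "K n - (\<Union>i. V i) \<subseteq> K m - (\<Union>i. V i)" if "m \<le> n" for m n
        using Kmono[OF that] by (rule Diff_mono) simp
      ultimately have "(\<Inter>n. K n - (\<Union>i. V i)) \<noteq> {}"
        by (intro compact_nest)
      moreover have "(\<Inter>n. K n - (\<Union>i. V i)) = support - (\<Union>i. V i)"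
        by (simp add: K)
      moreover have "(\<Union>i. U i) \<subseteq> (\<Union>i. V i)"
        by (intro UN_mono UV order_refl)
      then have "support - (\<Union>i. V i) = {}"
        unfolding Diff_eq_empty_iff using U(1) by (rule order_trans[rotated])
      ultimately show False by metis
    qed
    then have "K n \<subseteq> (\<Union>i. V i)" by blast
    then obtain I where I: "finite I" "K n \<subseteq> (\<Union>i\<in>I. V i)"
      using compactE_image[OF compK[of n], of UNIV V] openV by metis
    have "\<forall>i. \<exists>N. \<forall>n\<ge>N. (\<Sum>j | j < 2^n \<and> \<bar>real j / 2^n - p i\<bar> < l i. M n j) \<le> B * l i powr s"
    proof
      fix i
      show "\<exists>N. \<forall>n\<ge>N. (\<Sum>j | j < 2^n \<and> \<bar>real j / 2^n - p i\<bar> < l i. M n j) \<le> B * l i powr s"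
        using ball_mass[OF bound s l0[of i], of "p i"] unfolding B_def by blast
    qed
    then obtain N where N: "\<And>i n. n \<ge> N i \<Longrightarrow>
        (\<Sum>j | j < 2^n \<and> \<bar>real j / 2^n - p i\<bar> < l i. M n j) \<le> B * l i powr s"
      by metis
    define m where "m = Max (insert n (N ` I))"
    have m: "m \<ge> n" "\<And>i. i \<in> I \<Longrightarrow> m \<ge> N i"
      using I(1) by (auto simp: m_def)
    define I' where "I' = {i \<in> I. U i \<noteq> {}}"
    have I': "finite I'" using I(1) by (simp add: I'_def)
    have cov: "\<exists>i\<in>I'. \<bar>real j / 2^m - p i\<bar> < l i" if j: "j < 2^m" "M m j > 0" for j
    proof -
      have "real j / 2^m \<in> K m"
        using j unfolding K_def dyadic_def by (intro UN_I[of j]) (auto simp: divide_right_mono)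
      then have "real j / 2^m \<in> (\<Union>i\<in>I. V i)" using I(2) Kmono[OF m(1)] by blast
      then obtain i where "i \<in> I" "real j / 2^m \<in> V i" by blast
      then show ?thesis
        by (intro bexI[of _ i]) (auto simp: V_def I'_def dist_real_def abs_minus_commute split: if_splits)
    qed
    have "1 = (\<Sum>j<2^m. M m j)" by (simp add: total_level)
    also have "\<dots> = (\<Sum>j | j < 2^m \<and> M m j > 0. M m j)"
      using nonneg by (intro sum.mono_neutral_right) (auto simp: less_le)
    also have "\<dots> \<le> (\<Sum>j\<in>(\<Union>i\<in>I'. {j. j < 2^m \<and> \<bar>real j / 2^m - p i\<bar> < l i}). M m j)"
      using cov nonneg I' by (intro sum_mono2) auto
    also have "\<dots> \<le> (\<Sum>i\<in>I'. \<Sum>j | j < 2^m \<and> \<bar>real j / 2^m - p i\<bar> < l i. M m j)"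
      using I' nonneg by (intro sum_UN_le) auto
    also have "\<dots> \<le> (\<Sum>i\<in>I'. B * l i powr s)"
      using N m(2) by (intro sum_mono) (auto simp: I'_def)
    also have "\<dots> = B * ((\<Sum>i\<in>I'. D i powr s) + \<epsilon> * (\<Sum>i\<in>I'. (1/2)^Suc i))"
      unfolding lpow by (simp add: sum_distrib_left sum.distrib algebra_simps)
    also have "\<dots> \<le> B * (\<epsilon> + \<epsilon> * 1)"
    proof -
      have "ennreal (\<Sum>i\<in>I'. D i powr s) = (\<Sum>i\<in>I'. ennreal (D i powr s))"
        by (simp add: sum_ennreal)
      also have "\<dots> \<le> (\<Sum>i\<in>I'. hausdorff_gauge t (U i))"
      proof (intro sum_mono)
        fix i assume "i \<in> I'"
        then have ne: "U i \<noteq> {}" by (simp add: I'_def)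
        show "ennreal (D i powr s) \<le> hausdorff_gauge t (U i)"
        proof (cases "t = 0")
          case True
          have "D i powr s \<le> 1" using D s by (intro powr_le1) auto
          then show ?thesis using True ne by (simp add: hausdorff_gauge_def)
        next
          case False
          have "D i powr s \<le> D i powr t" using D[of i] ts by (intro powr_mono') auto
          then show ?thesis using False ne by (simp add: hausdorff_gauge_def D_def ennreal_leI)
        qed
      qed
      also have "\<dots> \<le> (\<Sum>i. hausdorff_gauge t (U i))"
        using I' by (intro sum_le_suminf) auto
      also have "\<dots> \<le> ennreal \<epsilon>" using U(4) by simp
      finally have "(\<Sum>i\<in>I'. D i powr s) \<le> \<epsilon>" using \<epsilon> by simp
      moreover have "(\<Sum>i\<in>I'. (1/2::real)^Suc i) \<le> (\<Sum>i. (1/2)^Suc i)"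
        using I' by (intro sum_le_suminf summable_ignore_initial_segment[of _ 1, simplified]) (auto intro!: summable_geometric)
      moreover have "(\<Sum>i. (1/2::real)^Suc i) = 1"
        using power_half_series by (rule sums_unique[symmetric])
      ultimately show ?thesis using B \<epsilon> by (intro mult_left_mono add_mono) auto
    qed
    also have "\<dots> = 1/2" using B by (simp add: \<epsilon>_def)
    finally show False by simp
  qed
  then show ?thesis
    unfolding hausdorff_dim_def by (auto intro!: Inf_greatest)
qed

end

section \<open>Takagi functions under halving\<close>

lemma phi_add_int: "phi (x + of_int k) = phi x"
proof -
  have "infdist (x + of_int k) \<int> = infdist x ((\<lambda>y. y - of_int k) ` \<int>)"
    unfolding infdist_def by (auto simp: dist_real_def image_image algebra_simps intro!: arg_cong[where f=Inf] image_cong)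
  also have "(\<lambda>y::real. y - of_int k) ` \<int> = \<int>"
  proof
    show "\<int> \<subseteq> (\<lambda>y::real. y - of_int k) ` \<int>"
      by (rule subsetI, rule_tac x = "x + of_int k" in image_eqI) auto
  qed auto
  finally show ?thesis by (simp add: phi_def)
qed

lemma phi_add_nat: "phi (x + of_nat k) = phi x"
  using phi_add_int[of x "int k"] by simp

lemma phi_of_nat [simp]: "phi (of_nat k) = 0"
  by (simp add: phi_def)

lemma phi_le: "phi x \<le> \<bar>x - of_int k\<bar>"
  unfolding phi_def by (rule order_trans[OF infdist_le[of "of_int k"]]) (auto simp: dist_real_def)

lemma phi_nonneg: "0 \<le> phi x"
  by (simp add: phi_def infdist_nonneg)

lemma phi_unit_interval: 
  assumes "0 \<le> u" "u \<le> 1"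
  shows "phi u = min u (1 - u)"
proof (rule antisym)
  show "phi u \<le> min u (1 - u)"
    using phi_le[of u 0] phi_le[of u 1] assms by simp
  have "min u (1 - u) \<le> dist u y" if y0: "y \<in> \<int>" for y
  proof -
    obtain k where y: "y = of_int k" using y0 by (rule Ints_cases)
    have "k \<le> 0 \<or> 1 \<le> k" by auto
    then have "of_int k \<le> (0::real) \<or> 1 \<le> (of_int k :: real)" by auto
    then show ?thesis using assms by (auto simp: y dist_real_def)
  qed
  then show "min u (1 - u) \<le> phi u"
    unfolding phi_def using Ints_0 by (subst infdist_notempty) (auto intro!: cINF_greatest)
qed

lemma phi_double_le: "phi (2 * x) \<le> 1 - 2 * phi x"
proof -
  define u where "u = x - of_int \<lfloor>x\<rfloor>"
  have u: "0 \<le> u" "u \<le> 1" unfolding u_def by linarith+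
  have "phi x = phi u" using phi_add_int[of u "\<lfloor>x\<rfloor>"] by (simp add: u_def)
  moreover have "phi (2 * x) \<le> \<bar>2 * u - 1\<bar>"
    using phi_le[of "2 * x" "2 * \<lfloor>x\<rfloor> + 1"] by (simp add: u_def algebra_simps)
  ultimately show ?thesis unfolding phi_unit_interval[OF u] by linarith
qed

lemma phi_le_half: "phi x \<le> 1/2"
  using phi_double_le[of x] phi_nonneg[of "2 * x"] by simp

lemma sign_cases:
  assumes "admissible_signs \<omega>" "x \<in> {0..1}"
  shows "\<omega> n x = 1 \<or> \<omega> n x = -1"
proof -
  have "\<omega> n x \<in> {-1, 1}" using assms unfolding admissible_signs_def by blast
  then show ?thesis by auto
qed

text \<open>
  Consecutive terms are grouped in pairs: \<open>phi y + phi (2 * y) / 2 \<le> 1/2\<close> by \<open>phi_double_le\<close>, so the series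
  is dominated by half the geometric series of ratio \<open>1/4\<close>.
\<close>

lemma takagi_bound:
  assumes "admissible_signs \<omega>" "takagi_expansion \<omega> f" "x \<in> {0..1}"
  shows "\<bar>f x\<bar> \<le> 2/3"
proof -
  have w: "\<bar>\<omega> n x\<bar> = 1" for n
    using sign_cases[OF assms(1,3), of n] by auto
  define S where "S n = (\<Sum>k<n. \<omega> k x / 2^k * phi (2^k * x))" for n
  have lim: "S \<longlonglongrightarrow> f x"
    using assms(2,3) unfolding takagi_expansion_def sums_def S_def by auto
  have "\<bar>S (2 * n)\<bar> \<le> 2/3 * (1 - (1/4)^n)" for n
  proof (induction n)
    case (Suc n)
    define y where "y = 2^(2*n) * x"
    have "S (2 * Suc n) = S (2 * n) + (\<omega> (2*n) x * phi y + \<omega> (2*n+1) x * phi (2 * y) / 2) / 2^(2*n)"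
      by (simp add: S_def y_def add_divide_distrib mult.assoc)
    also have "\<bar>\<dots>\<bar> \<le> \<bar>S (2 * n)\<bar> + (phi y + phi (2 * y) / 2) / 2^(2*n)"
    proof -
      have "\<bar>\<omega> (2*n) x * phi y + \<omega> (2*n+1) x * phi (2 * y) / 2\<bar> \<le> \<bar>\<omega> (2*n) x * phi y\<bar> + \<bar>\<omega> (2*n+1) x * phi (2 * y) / 2\<bar>"
        by (rule abs_triangle_ineq)
      also have "\<dots> = phi y + phi (2 * y) / 2"
        using phi_nonneg by (simp add: abs_mult w)
      finally show ?thesis
        by (intro order_trans[OF abs_triangle_ineq] add_left_mono) (simp add: divide_right_mono)
    qed
    also have "(phi y + phi (2 * y) / 2) / 2^(2*n) \<le> (1/2) / 2^(2*n)"
      using phi_double_le[of y] by (intro divide_right_mono) auto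
    also have "\<bar>S (2 * n)\<bar> + (1/2) / 2^(2*n) \<le> 2/3 * (1 - (1/4)^n) + (1/2) / 2^(2*n)"
      using Suc by simp
    also have "\<dots> = 2/3 * (1 - (1/4)^Suc n)"
      using power_mult[of "2::real" 2 n] by (simp add: power_divide field_simps)
    finally show ?case by simp
  qed (simp add: S_def)
  then have "\<bar>S (2 * n)\<bar> \<le> 2/3" for n
    by (rule order_trans) simp
  moreover have "(\<lambda>n. \<bar>S (2 * n)\<bar>) \<longlonglongrightarrow> \<bar>f x\<bar>"
    using LIMSEQ_subseq_LIMSEQ[OF lim, of "\<lambda>n. 2 * n"] by (intro tendsto_rabs) (auto simp: strict_mono_def o_def)
  ultimately show ?thesis by (intro LIMSEQ_le_const2) auto
qed

text \<open>
  The first term of the expansion is affine on each half, and since \<open>phi\<close> has period one the remaining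
  terms form an expansion of the same kind with the signs shifted by one level. The values at
  the right end points cause no trouble because \<open>phi\<close> vanishes at integers.
\<close>

lemma dyadic_parts:
  assumes "admissible_signs \<omega>" "takagi_expansion \<omega> f" and i: "i < (2::nat)"
  defines "\<omega>' \<equiv> \<lambda>n u. \<omega> (Suc n) ((u + real i) / 2)"
    and "g \<equiv> \<lambda>u. 2 * f ((u + real i) / 2) - \<omega> 0 0 * (if i = 0 then u else 1 - u)"
  shows "admissible_signs \<omega>'" "takagi_expansion \<omega>' g"
proof -
  have i01: "i = 0 \<or> i = 1" using i by auto
  have in01: "(u + real i) / 2 \<in> {0..1}" if "u \<in> {0..1}" for u using that i01 by auto
  show "admissible_signs \<omega>'"
    unfolding admissible_signs_def
  proof (intro conjI allI ballI impI)
    fix n u assume "u \<in> {0..1::real}"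
    then show "\<omega>' n u \<in> {-1, 1}"
      using assms(1) in01 unfolding \<omega>'_def admissible_signs_def by blast
  next
    fix n j :: nat assume j: "j < 2^n"
    have "j + i * 2^n < 2^Suc n" using j i01 by auto
    then have "\<omega> (Suc n) constant_on {real (j + i * 2^n) / 2^Suc n ..< (real (j + i * 2^n) + 1) / 2^Suc n}"
      using assms(1) unfolding admissible_signs_def by blast
    then obtain c where c: "\<And>x. x \<in> {real (j + i * 2^n) / 2^Suc n ..< (real (j + i * 2^n) + 1) / 2^Suc n} \<Longrightarrow> \<omega> (Suc n) x = c"
      unfolding constant_on_def by blast
    have "\<omega>' n u = c" if "u \<in> {real j / 2^n ..< (real j + 1) / 2^n}" for u
      unfolding \<omega>'_def by (rule c) (use that in \<open>auto simp: field_simps\<close>)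
    then show "\<omega>' n constant_on {real j / 2^n ..< (real j + 1) / 2^n}"
      unfolding constant_on_def by blast
  qed
  show "takagi_expansion \<omega>' g"
    unfolding takagi_expansion_def
  proof
    fix u :: real assume u: "u \<in> {0..1}"
    define x where "x = (u + real i) / 2"
    have x: "x \<in> {0..1}" using in01[OF u] by (simp add: x_def)
    define a where "a n = \<omega> n x / 2^n * phi (2^n * x)" for n
    have "a sums f x" using assms(2) x unfolding takagi_expansion_def a_def by blast
    then have "(\<lambda>n. a (Suc n)) sums (f x - a 0)" by (subst sums_Suc_iff) simp
    then have "(\<lambda>n. 2 * a (Suc n)) sums (2 * (f x - a 0))" by (rule sums_mult)
    moreover have "2 * a (Suc n) = \<omega>' n u / 2^n * phi (2^n * u)" for n
    proof -
      have "2^Suc n * x = 2^n * u + real (2^n * i)" by (simp add: x_def algebra_simps)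
      then have "phi (2^Suc n * x) = phi (2^n * u)" using phi_add_nat by metis
      then show ?thesis by (simp add: a_def \<omega>'_def x_def)
    qed
    moreover have "2 * (f x - a 0) = g u"
    proof (cases "x = 1")
      case True
      then have "i = 1" "u = 1" using u i01 by (auto simp: x_def)
      moreover have "phi 1 = 0" using phi_of_nat[of 1] by simp
      ultimately show ?thesis using True by (simp add: a_def g_def)
    next
      case False
      have "\<omega> 0 constant_on {0..<1}"
        using assms(1) unfolding admissible_signs_def by (metis div_by_1 less_numeral_extra(1) of_nat_0 add_0 power_0)
      moreover have "x \<in> {0..<1}" using x False by auto
      ultimately have "\<omega> 0 x = \<omega> 0 0" unfolding constant_on_def by auto
      moreover have "2 * phi x = (if i = 0 then u else 1 - u)"
        using u i01 x phi_unit_interval[of x] by (auto simp: x_def min_def field_simps)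
      ultimately have "2 * a 0 = \<omega> 0 0 * (if i = 0 then u else 1 - u)" by (simp add: a_def)
      then show ?thesis by (simp add: g_def x_def algebra_simps)
    qed
    ultimately show "(\<lambda>n. \<omega>' n u / 2^n * phi (2^n * u)) sums g u" by simp
  qed
qed

lemma T_v_split:
  assumes "f \<in> T_v"
  obtains w gL gR where "w = 1 \<or> w = (-1::int)" "gL \<in> T_v" "gR \<in> T_v"
    "\<And>u. f (u / 2) = (of_int w * u + gL u) / 2"
    "\<And>u. f ((u + 1) / 2) = (of_int w * (1 - u) + gR u) / 2"
proof -
  obtain \<omega> where \<omega>: "admissible_signs \<omega>" "takagi_expansion \<omega> f"
    using assms unfolding T_v_def by blast
  obtain w :: int where w: "w = 1 \<or> w = -1" "of_int w = \<omega> 0 0"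
    using sign_cases[OF \<omega>(1), of 0 0] by (metis of_int_1 of_int_minus atLeastAtMost_iff order_refl zero_le_one)
  have g: "(\<lambda>u. 2 * f ((u + real i) / 2) - \<omega> 0 0 * (if i = 0 then u else 1 - u)) \<in> T_v" if "i < 2" for i
    using dyadic_parts[OF \<omega> that] unfolding T_v_def by blast
  show ?thesis
    by (rule that[OF w(1) g[of 0] g[of 1]]) (auto simp: w(2))
qed

lemma T_c_split:
  assumes "f \<in> T_c"
  obtains w gL gR where "w = 1 \<or> w = (-1::int)" "gL \<in> T_c" "gR \<in> T_c"
    "\<And>u. f (u / 2) = (of_int w * u + gL u) / 2"
    "\<And>u. f ((u + 1) / 2) = (of_int w * (1 - u) + gR u) / 2"
proof -
  obtain \<omega> where \<omega>: "admissible_signs \<omega>" "takagi_expansion \<omega> f" "\<And>n. \<omega> n constant_on {0..1}"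
    using assms unfolding T_c_def by blast
  obtain w :: int where w: "w = 1 \<or> w = -1" "of_int w = \<omega> 0 0"
    using sign_cases[OF \<omega>(1), of 0 0] by (metis of_int_1 of_int_minus atLeastAtMost_iff order_refl zero_le_one)
  have "(\<lambda>u. \<omega> (Suc n) ((u + real i) / 2)) constant_on {0..1}" if "i < 2" for i n
    using \<omega>(3)[of "Suc n"] that less_2_cases[OF that] unfolding constant_on_def by fastforce
  then have g: "(\<lambda>u. 2 * f ((u + real i) / 2) - \<omega> 0 0 * (if i = 0 then u else 1 - u)) \<in> T_c" if "i < 2" for i
    using dyadic_parts[OF \<omega>(1,2) that] that unfolding T_c_def by blast
  show ?thesis
    by (rule that[OF w(1) g[of 0] g[of 1]]) (auto simp: w(2))
qed

text \<open>
  A partial converse of \<open>T_v_split\<close>: any \<open>g\<close> in the class can be planted on the left half; the right half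
  is filled with \<open>g\<close> as well, which keeps the signs admissible.
\<close>

lemma T_v_join:
  assumes "g \<in> T_v" "w = 1 \<or> w = (-1::int)"
  obtains f where "f \<in> T_v"
    "\<And>u. u \<in> {0..1} \<Longrightarrow> f (u / 2) = (of_int w * u + g u) / 2"
proof -
  obtain \<omega> where \<omega>: "admissible_signs \<omega>" "takagi_expansion \<omega> g"
    using assms unfolding T_v_def by blast
  define \<omega>' where "\<omega>' n x = (case n of 0 \<Rightarrow> of_int w | Suc m \<Rightarrow> if x < 1/2 then \<omega> m (2 * x) else \<omega> m (2 * x - 1))" for n and x :: real
  define f where "f x = of_int w * phi x + (if x < 1/2 then g (2 * x) else g (2 * x - 1)) / 2" for x
  have adm: "admissible_signs \<omega>'"
    unfolding admissible_signs_def
  proof (intro conjI allI ballI impI)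
    fix n and x :: real assume "x \<in> {0..1}"
    then show "\<omega>' n x \<in> {-1, 1}"
      using assms(2) \<omega>(1) unfolding admissible_signs_def \<omega>'_def by (cases n) auto
  next
    fix n j :: nat assume j: "j < 2^n"
    show "\<omega>' n constant_on {real j / 2^n ..< (real j + 1) / 2^n}"
    proof (cases n)
      case 0
      then show ?thesis by (auto simp: \<omega>'_def constant_on_def)
    next
      case (Suc m)
      define h where "h = (if j < 2^m then 0 else 1::nat)"
      define k where "k = j - h * 2^m"
      have jk: "j = k + h * 2^m" "k < 2^m" using j Suc by (auto simp: k_def h_def)
      obtain c where c: "\<And>x. x \<in> {real k / 2^m ..< (real k + 1) / 2^m} \<Longrightarrow> \<omega> m x = c"
        using \<omega>(1) jk(2) unfolding admissible_signs_def constant_on_def by blast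
      have "\<omega>' n x = c" if x: "x \<in> {real j / 2^n ..< (real j + 1) / 2^n}" for x
      proof -
        have 1: "2 * x - real h \<in> {real k / 2^m ..< (real k + 1) / 2^m}"
          using x unfolding jk(1) Suc by (auto simp: field_simps)
        have "real k / 2^m \<ge> 0" by simp
        moreover have "(real k + 1) / 2^m \<le> 1"
          using jk(2) by (simp add: field_simps) (metis Suc_leI of_nat_Suc of_nat_le_iff of_nat_numeral of_nat_power add.commute)
        ultimately have "0 \<le> 2 * x - real h" "2 * x - real h < 1"
          using 1 unfolding atLeastLessThan_iff by linarith+
        then have "x < 1/2 \<longleftrightarrow> h = 0" by (auto simp: h_def split: if_splits)
        then have "\<omega>' n x = \<omega> m (2 * x - real h)" by (auto simp: \<omega>'_def Suc h_def)
        then show ?thesis using c[OF 1] by simp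
      qed
      then show ?thesis unfolding constant_on_def by blast
    qed
  qed
  have "takagi_expansion \<omega>' f"
    unfolding takagi_expansion_def
  proof
    fix x :: real assume x: "x \<in> {0..1}"
    define h where "h = (if x < 1/2 then 0 else 1::nat)"
    have u: "2 * x - real h \<in> {0..1}" using x by (auto simp: h_def)
    define a where "a n = \<omega>' n x / 2^n * phi (2^n * x)" for n
    have "a (Suc n) = \<omega> n (2 * x - real h) / 2^n * phi (2^n * (2 * x - real h)) / 2" for n
    proof -
      have "2^Suc n * x = 2^n * (2 * x - real h) + real (2^n * h)" by (simp add: algebra_simps)
      then have "phi (2^Suc n * x) = phi (2^n * (2 * x - real h))" using phi_add_nat by metis
      then show ?thesis by (auto simp: a_def \<omega>'_def h_def)
    qed
    moreover have "(\<lambda>n. \<omega> n (2 * x - real h) / 2^n * phi (2^n * (2 * x - real h)) / 2) sums (g (2 * x - real h) / 2)"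
      using \<omega>(2) u unfolding takagi_expansion_def by (intro sums_divide) auto
    ultimately have "(\<lambda>n. a (Suc n)) sums (g (2 * x - real h) / 2)" by simp
    then have "a sums (g (2 * x - real h) / 2 + a 0)" by (subst (asm) sums_Suc_iff) simp
    moreover have "g (2 * x - real h) / 2 + a 0 = f x"
      by (auto simp: a_def \<omega>'_def f_def h_def)
    ultimately show "(\<lambda>n. \<omega>' n x / 2^n * phi (2^n * x)) sums f x" unfolding a_def by simp
  qed
  then have "f \<in> T_v" using adm unfolding T_v_def by blast
  moreover have "f (u / 2) = (of_int w * u + g u) / 2" if "u \<in> {0..1}" for u
  proof -
    have "g 0 = 0" "g 1 = 0"
    proof -
      have "(\<lambda>n. \<omega> n 0 / 2^n * phi (2^n * 0)) sums g 0" "(\<lambda>n. \<omega> n 1 / 2^n * phi (2^n * 1)) sums g 1"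
        using \<omega>(2) unfolding takagi_expansion_def by (blast intro: atLeastAtMost_iff[THEN iffD2] zero_le_one order_refl)+
      moreover have "phi (2^n * 1) = 0" "phi (2^n * 0) = 0" for n
        using phi_of_nat[of "2^n"] phi_of_nat[of 0] by simp_all
      ultimately show "g 0 = 0" "g 1 = 0" by (simp_all only: mult_zero_right sums_unique2[OF _ sums_zero])
    qed
    moreover have "phi (u / 2) = u / 2" using that phi_unit_interval[of "u / 2"] by auto
    ultimately show ?thesis using that by (cases "u = 1") (auto simp: f_def add_divide_distrib)
  qed
  ultimately show ?thesis by (rule that)
qed

section \<open>Intersections with lines\<close>

definition crossings :: "(real \<Rightarrow> real) \<Rightarrow> real \<Rightarrow> real \<Rightarrow> real set" where
  "crossings f m b = {u \<in> {0..1}. f u = m * u + b}"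

lemma hausdorff_dim_graph_inter_line:
  "hausdorff_dim (Graph f \<inter> line m b) = hausdorff_dim (crossings f m b)"
proof (rule antisym)
  show "hausdorff_dim (Graph f \<inter> line m b) \<le> hausdorff_dim (crossings f m b)"
  proof (rule hausdorff_dim_lipschitz_image[where g = "\<lambda>u. (u, m * u + b)" and L = "1 + \<bar>m\<bar>"])
    show "Graph f \<inter> line m b \<subseteq> (\<lambda>u. (u, m * u + b)) ` crossings f m b"
      by (auto simp: Graph_def line_def crossings_def)
    fix u v :: real
    have "dist (u, m * u + b) (v, m * v + b) \<le> \<bar>u - v\<bar> + \<bar>m * u - m * v\<bar>"
      unfolding dist_Pair_Pair dist_real_def using sqrt_sum_squares_le_sum_abs[of "\<bar>u - v\<bar>" "\<bar>m * u - m * v\<bar>"] by simp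
    also have "\<bar>m * u - m * v\<bar> = \<bar>m\<bar> * \<bar>u - v\<bar>"
      by (simp flip: abs_mult right_diff_distrib)
    finally show "dist (u, m * u + b) (v, m * v + b) \<le> (1 + \<bar>m\<bar>) * dist u v"
      by (simp add: dist_real_def algebra_simps)
  qed simp
  show "hausdorff_dim (crossings f m b) \<le> hausdorff_dim (Graph f \<inter> line m b)"
  proof (rule hausdorff_dim_lipschitz_image[where g = fst and L = 1])
    show "crossings f m b \<subseteq> fst ` (Graph f \<inter> line m b)"
      by (force simp: Graph_def line_def crossings_def image_iff)
  qed (auto simp: dist_fst_le)
qed

lemma covered_mono: "covered n c Z \<Longrightarrow> c \<le> c' \<Longrightarrow> Z' \<subseteq> Z \<Longrightarrow> covered n c' Z'"
  unfolding covered_def by (meson order_trans)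

lemma covered_halves:
  assumes "covered n c Z" "covered n d Y"
  shows "covered (Suc n) (c + d) ((\<lambda>u. u / 2) ` Z \<union> (\<lambda>u. (u + 1) / 2) ` Y)"
proof -
  obtain J where J: "finite J" "real (card J) \<le> c" "Z \<subseteq> (\<Union>j\<in>J. dyadic n j)"
    using assms(1) unfolding covered_def by blast
  obtain K where K: "finite K" "real (card K) \<le> d" "Y \<subseteq> (\<Union>j\<in>K. dyadic n j)"
    using assms(2) unfolding covered_def by blast
  let ?I = "J \<union> (\<lambda>j. j + 2^n) ` K"
  have "card ?I \<le> card J + card K"
    using card_Un_le[of J] card_image_le[OF K(1), of "\<lambda>j. j + 2^n"] by (meson add_left_mono order_trans)
  then have "real (card ?I) \<le> c + d" using J(2) K(2) by linarith
  moreover have "u / 2 \<in> (\<Union>j\<in>?I. dyadic (Suc n) j)" if u: "u \<in> Z" for u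
  proof -
    obtain j where "j \<in> J" "u \<in> dyadic n j" using J(3) u by blast
    then show ?thesis
      by (intro UN_I[of j]) (auto simp: dyadic_def field_simps)
  qed
  moreover have "(u + 1) / 2 \<in> (\<Union>j\<in>?I. dyadic (Suc n) j)" if u: "u \<in> Y" for u
  proof -
    obtain j where "j \<in> K" "u \<in> dyadic n j" using K(3) u by blast
    then show ?thesis
      by (intro UN_I[of "j + 2^n"]) (auto simp: dyadic_def field_simps)
  qed
  ultimately show ?thesis
    unfolding covered_def using J(1) K(1) by (intro exI[of _ ?I]) blast
qed

lemma crossings_split:
  assumes "\<And>u. f (u / 2) = (w * u + gL u) / 2" "\<And>u. f ((u + 1) / 2) = (w * (1 - u) + gR u) / 2"
  shows "crossings f m b = (\<lambda>u. u / 2) ` crossings gL (m - w) (2 * b) \<union>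
    (\<lambda>u. (u + 1) / 2) ` crossings gR (m + w) (2 * b + m - w)" (is "_ = ?L \<union> ?R")
proof
  have L: "f (u / 2) = m * (u / 2) + b \<longleftrightarrow> gL u = (m - w) * u + 2 * b" for u
    unfolding assms(1) by (auto simp: field_simps)
  have R: "f ((u + 1) / 2) = m * ((u + 1) / 2) + b \<longleftrightarrow> gR u = (m + w) * u + (2 * b + m - w)" for u
    unfolding assms(2) by (auto simp: field_simps)
  show "crossings f m b \<subseteq> ?L \<union> ?R"
  proof
    fix x assume x: "x \<in> crossings f m b"
    show "x \<in> ?L \<union> ?R"
    proof (cases "x \<le> 1/2")
      case True
      then have "2 * x \<in> crossings gL (m - w) (2 * b)"
        using x L[of "2 * x"] by (auto simp: crossings_def)
      then show ?thesis by (auto intro!: rev_image_eqI)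
    next
      case False
      then have "2 * x - 1 \<in> crossings gR (m + w) (2 * b + m - w)"
        using x R[of "2 * x - 1"] by (auto simp: crossings_def)
      then show ?thesis by (intro UnI2) (auto intro!: rev_image_eqI)
    qed
  qed
  show "?L \<union> ?R \<subseteq> crossings f m b"
    using L R by (auto simp: crossings_def)
qed

lemma hausdorff_dim_crossings_left:
  assumes "\<And>u. u \<in> {0..1} \<Longrightarrow> f (u / 2) = (w * u + g u) / 2"
  shows "hausdorff_dim (crossings g (m - w) b) \<le> hausdorff_dim (crossings f m (b / 2))"
proof (rule hausdorff_dim_lipschitz_image[where g = "\<lambda>u. 2 * u" and L = 2])
  show "crossings g (m - w) b \<subseteq> (\<lambda>u. 2 * u) ` crossings f m (b / 2)"
  proof
    fix u assume "u \<in> crossings g (m - w) b"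
    then have "u / 2 \<in> crossings f m (b / 2)"
      using assms[of u] by (auto simp: crossings_def field_simps)
    then show "u \<in> (\<lambda>u. 2 * u) ` crossings f m (b / 2)" by (auto intro!: rev_image_eqI)
  qed
qed (auto simp: dist_real_def abs_if)

lemma hausdorff_dim_crossings_right:
  assumes "\<And>u. u \<in> {0..1} \<Longrightarrow> f ((u + 1) / 2) = (w * (1 - u) + g u) / 2"
  shows "hausdorff_dim (crossings g (m + w) b) \<le> hausdorff_dim (crossings f m ((b - m + w) / 2))"
proof (rule hausdorff_dim_lipschitz_image[where g = "\<lambda>u. 2 * u - 1" and L = 2])
  show "crossings g (m + w) b \<subseteq> (\<lambda>u. 2 * u - 1) ` crossings f m ((b - m + w) / 2)"
  proof
    fix u assume "u \<in> crossings g (m + w) b"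
    then have "(u + 1) / 2 \<in> crossings f m ((b - m + w) / 2)"
      using assms[of u] by (auto simp: crossings_def field_simps)
    then show "u \<in> (\<lambda>u. 2 * u - 1) ` crossings f m ((b - m + w) / 2)"
      by (rule rev_image_eqI) (simp add: field_simps)
  qed
qed (auto simp: dist_real_def abs_if)

text \<open>
  In the scale \<open>2^n\<close>, the partial sum of the first \<open>n\<close> terms is \<open>offset e n j + slope e n j * u\<close> at the point
  \<open>(j + u) / 2^n\<close>, where \<open>e n j\<close> is the sign of level \<open>n\<close> on the \<open>j\<close>-th interval.
\<close>

fun slope :: "(nat \<Rightarrow> nat \<Rightarrow> int) \<Rightarrow> nat \<Rightarrow> nat \<Rightarrow> int" where
  "slope e 0 j = 0"
| "slope e (Suc n) j = slope e n (j div 2) + (if even j then e n (j div 2) else - e n (j div 2))"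

fun offset :: "(nat \<Rightarrow> nat \<Rightarrow> int) \<Rightarrow> nat \<Rightarrow> nat \<Rightarrow> int" where
  "offset e 0 j = 0"
| "offset e (Suc n) j = 2 * offset e n (j div 2) + (if even j then 0 else slope e n (j div 2) + e n (j div 2))"

text \<open>
  Induction on the level: halving the piece with index \<open>j div 2\<close> by \<open>dyadic_parts\<close> produces the piece \<open>j\<close>.
\<close>

lemma dyadic_restriction:
  assumes \<omega>: "admissible_signs \<omega>" "takagi_expansion \<omega> f"
    and e: "\<And>n j. j < 2^n \<Longrightarrow> real_of_int (e n j) = \<omega> n (real j / 2^n)"
    and j: "j < 2^n"
  shows "admissible_signs (\<lambda>k u. \<omega> (n + k) ((real j + u) / 2^n)) \<and>
    takagi_expansion (\<lambda>k u. \<omega> (n + k) ((real j + u) / 2^n))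
      (\<lambda>u. 2^n * f ((real j + u) / 2^n) - of_int (offset e n j) - of_int (slope e n j) * u)"
  using j
proof (induction n arbitrary: j)
  case 0
  then show ?case using \<omega> by simp
next
  case (Suc n)
  define i where "i = j div 2"
  define p where "p = j mod 2"
  have i: "i < 2^n" using Suc.prems by (simp add: i_def less_mult_imp_div_less)
  have p: "p < 2" by (simp add: p_def)
  have j: "j = 2 * i + p" by (simp add: i_def p_def)
  have pt: "(real i + (u + real p) / 2) / 2^n = (real j + u) / 2^Suc n" for u
    by (simp add: j field_simps)
  have e0: "\<omega> n (real i / 2^n) = real_of_int (e n i)" using e[OF i] by simp
  note IH = Suc.IH[OF i, THEN conjunct1] Suc.IH[OF i, THEN conjunct2]
  have val: "2 * (2^n * f ((real i + (u + real p) / 2) / 2^n) - of_int (offset e n i)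
        - of_int (slope e n i) * ((u + real p) / 2)) - \<omega> (n + 0) ((real i + 0) / 2^n) * (if p = 0 then u else 1 - u)
    = 2^Suc n * f ((real j + u) / 2^Suc n) - of_int (offset e (Suc n) j) - of_int (slope e (Suc n) j) * u" for u
  proof -
    have "p = 0 \<or> p = 1" using p by auto
    then show ?thesis
      unfolding pt using e0 by (auto simp: j algebra_simps)
  qed
  show ?case
    using dyadic_parts[OF IH p] unfolding val by (simp only: pt add_Suc_right add_Suc simp_thms)
qed

lemma affine_approx:
  assumes \<omega>: "admissible_signs \<omega>" "takagi_expansion \<omega> f"
    and e: "\<And>n j. j < 2^n \<Longrightarrow> real_of_int (e n j) = \<omega> n (real j / 2^n)"
    and j: "j < 2^n" and x: "x \<in> dyadic n j"
  shows "\<bar>2^n * f x - of_int (offset e n j) - of_int (slope e n j) * (2^n * x - real j)\<bar> \<le> 2/3"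
proof -
  have u: "2^n * x - real j \<in> {0..1}" "x = (real j + (2^n * x - real j)) / 2^n"
    using x by (auto simp: dyadic_def field_simps)
  have "admissible_signs (\<lambda>k u. \<omega> (n + k) ((real j + u) / 2^n)) \<and>
    takagi_expansion (\<lambda>k u. \<omega> (n + k) ((real j + u) / 2^n))
      (\<lambda>u. 2^n * f ((real j + u) / 2^n) - of_int (offset e n j) - of_int (slope e n j) * u)"
    using \<omega> e j by (rule dyadic_restriction)
  note R = takagi_bound[OF conjunct1[OF this] conjunct2[OF this] u(1)]
  have "\<bar>2^n * f ((real j + (2^n * x - real j)) / 2^n) - of_int (offset e n j) - of_int (slope e n j) * (2^n * x - real j)\<bar> \<le> 2/3"
    using R .
  then show ?thesis
    using u(2) by simp
qed

section \<open>Constant signs: the upper bound\<close>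

lemma T_c_signs:
  assumes "f \<in> T_c"
  obtains \<omega> and c :: "nat \<Rightarrow> int" where "admissible_signs \<omega>" "takagi_expansion \<omega> f"
    "\<And>n. c n = 1 \<or> c n = -1" "\<And>n j. j < 2^n \<Longrightarrow> real_of_int (c n) = \<omega> n (real j / 2^n)"
proof -
  obtain \<omega> where \<omega>: "admissible_signs \<omega>" "takagi_expansion \<omega> f" "\<And>n. \<omega> n constant_on {0..1}"
    using assms unfolding T_c_def by blast
  have "\<forall>n. \<exists>c. (c = 1 \<or> c = -1) \<and> real_of_int c = \<omega> n 0"
    using sign_cases[OF \<omega>(1), of 0] by (metis of_int_1 of_int_minus atLeastAtMost_iff order_refl zero_le_one)
  then obtain c where c: "\<And>n. c n = 1 \<or> c n = -1" "\<And>n. real_of_int (c n) = \<omega> n 0" by metis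
  have "real_of_int (c n) = \<omega> n (real j / 2^n)" if "j < 2^n" for n j
  proof -
    have "real j / 2^n \<in> {0..1}" using that by (auto simp: field_simps)
    then show ?thesis using \<omega>(3)[of n] c(2)[of n] unfolding constant_on_def by force
  qed
  then show ?thesis using that \<omega> c by blast
qed

context
  fixes c :: "nat \<Rightarrow> int"
  assumes c: "\<And>n. c n = 1 \<or> c n = -1"
begin

abbreviation slope_c :: "nat \<Rightarrow> nat \<Rightarrow> int" where "slope_c \<equiv> slope (\<lambda>n _. c n)"
abbreviation offset_c :: "nat \<Rightarrow> nat \<Rightarrow> int" where "offset_c \<equiv> offset (\<lambda>n _. c n)"

lemma odd_c: "odd (c n)" using c[of n] by auto

lemma slope_parity: "even (slope_c n j + int n)"
  by (induction n arbitrary: j) (auto simp: odd_c)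

lemma offset_parity: "even (offset_c n j + int n * int j)"
proof (induction n arbitrary: j)
  case (Suc n)
  show ?case using slope_parity[of n "j div 2"] by (auto simp: odd_c)
qed simp

lemma slope_bound: "\<bar>slope_c n j\<bar> \<le> int n"
proof (induction n arbitrary: j)
  case (Suc n)
  show ?case using Suc[of "j div 2"] c[of n] by auto
qed simp

text \<open>
  A pair \<open>(v, s)\<close> of level \<open>n + 1\<close> has one possible left parent and one possible right parent. If
  \<open>n + m\<close> is even, \<open>v \<equiv> (n + 1 + m) j\<close> modulo two has the parity of \<open>j\<close>, so that only one of the two
  occurs; hence the multiplicity doubles at most at every second level.
\<close>

lemma card_same_piece:
  "card {j. j < 2^n \<and> offset_c n j - m * int j = v \<and> slope_c n j = s}
    \<le> 2 ^ ((n + (if even m then 0 else 1)) div 2)"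
proof (induction n arbitrary: v s)
  case 0
  have "card {j. j < (2::nat)^0 \<and> offset_c 0 j - m * int j = v \<and> slope_c 0 j = s} \<le> card {0::nat}"
    by (intro card_mono) auto
  then show ?case by simp
next
  case (Suc n)
  define F where "F n v s = {j::nat. j < 2^n \<and> offset_c n j - m * int j = v \<and> slope_c n j = s}" for n v s
  define K where "K n = (2::nat) ^ ((n + (if even m then 0 else 1)) div 2)" for n
  have fin: "finite (F n v s)" for n v s by (simp add: F_def)
  have IH: "card (F n v s) \<le> K n" for v s using Suc by (simp add: F_def K_def)
  let ?E = "F (Suc n) v s \<inter> {j. even j}"
  let ?O = "F (Suc n) v s \<inter> {j. odd j}"
  have "?E \<subseteq> (\<lambda>i. 2 * i) ` F n (v div 2) (s - c n)"
    by (auto simp: F_def elim!: evenE intro!: image_eqI)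
  then have E: "card ?E \<le> K n"
    by (rule order_trans[OF card_mono[OF finite_imageI[OF fin]] order_trans[OF card_image_le[OF fin] IH]])
  have "?O \<subseteq> (\<lambda>i. 2 * i + 1) ` F n ((v - s - 2 * c n + m) div 2) (s + c n)"
    by (auto simp: F_def algebra_simps elim!: oddE intro!: image_eqI)
  then have O: "card ?O \<le> K n"
    by (rule order_trans[OF card_mono[OF finite_imageI[OF fin]] order_trans[OF card_image_le[OF fin] IH]])
  have "F (Suc n) v s = ?E \<union> ?O" by blast
  then have EO: "card (F (Suc n) v s) \<le> card ?E + card ?O" by (metis card_Un_le)
  have "card (F (Suc n) v s) \<le> K (Suc n)"
  proof (cases "even (int n + m)")
    case True
    have par: "even j \<longleftrightarrow> even v" if "j \<in> F (Suc n) v s" for j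
    proof -
      have "even (offset_c (Suc n) j + int (Suc n) * int j)" by (rule offset_parity)
      moreover have "offset_c (Suc n) j = v + m * int j" using that by (simp add: F_def)
      ultimately show ?thesis using True by (auto simp del: offset.simps)
    qed
    have "card (F (Suc n) v s) \<le> K n"
    proof (cases "even v")
      case True
      then have "F (Suc n) v s = ?E" using par by auto
      then show ?thesis using E by simp
    next
      case False
      then have "F (Suc n) v s = ?O" using par by auto
      then show ?thesis using O by simp
    qed
    also have "K n \<le> K (Suc n)" unfolding K_def by (intro power_increasing) auto
    finally show ?thesis .
  next
    case False
    then have "K (Suc n) = 2 * K n" unfolding K_def by (auto elim!: evenE oddE)
    then show ?thesis using EO E O by linarith
  qed
  then show ?case by (simp add: F_def K_def)
qed

end

lemma int_in_floor_window:
  fixes y :: real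
  assumes "\<bar>y - of_int v - q\<bar> \<le> 2/3" "\<bar>q\<bar> \<le> of_int K"
  shows "v \<in> {\<lfloor>y\<rfloor> - (K + 1) .. \<lfloor>y\<rfloor> + (K + 1) + 1}"
proof -
  have "of_int v \<le> y + of_int K + 1" "y \<le> of_int v + of_int K + 1"
    using assms by linarith+
  then show ?thesis by simp linarith
qed

text \<open>
  A piece that meets the line has relative slope at most \<open>n + \<bar>m\<bar>\<close> in absolute value, so its relative end
  value lies in a window of that size. This leaves quadratically many pairs, each shared by few
  pieces according to \<open>card_same_piece\<close>.
\<close>

lemma T_c_covered:
  assumes "f \<in> T_c"
  shows "covered n ((2 * real n + 1) * (2 * (real n + \<bar>of_int m\<bar>) + 5) * 2 ^ ((n + 1) div 2)) (crossings f (of_int m) b)"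
proof -
  obtain \<omega> c where \<omega>: "admissible_signs \<omega>" "takagi_expansion \<omega> f"
    and c: "\<And>n. c n = 1 \<or> c n = (-1::int)" "\<And>n j. j < 2^n \<Longrightarrow> real_of_int (c n) = \<omega> n (real j / 2^n)"
    using T_c_signs[OF assms] by metis
  let ?s = "slope (\<lambda>n _. c n) n"
  let ?v = "\<lambda>j. offset (\<lambda>n _. c n) n j - m * int j"
  define R where "R = int n + \<bar>m\<bar> + 1"
  define V where "V = {\<lfloor>2^n * b\<rfloor> - R .. \<lfloor>2^n * b\<rfloor> + R + 1}"
  define S where "S = {- int n .. int n}"
  define F where "F = (\<lambda>(v, s). {j. j < (2::nat)^n \<and> ?v j = v \<and> ?s j = s})"
  define J where "J = (\<Union>p\<in>V \<times> S. F p)"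
  have finF: "finite (F p)" for p by (auto simp: F_def split: prod.splits)
  have "card (F p) \<le> 2 ^ ((n + 1) div 2)" for p
  proof -
    have "card (F p) \<le> 2 ^ ((n + (if even m then 0 else 1)) div 2)"
      using card_same_piece[of c n m "fst p" "snd p", OF c(1)] by (simp add: F_def case_prod_beta)
    also have "\<dots> \<le> 2 ^ ((n + 1) div 2)" by (intro power_increasing div_le_mono) auto
    finally show ?thesis .
  qed
  then have "card J \<le> card (V \<times> S) * 2 ^ ((n + 1) div 2)"
    unfolding J_def
    by (intro order_trans[OF card_UN_le] order_trans[OF sum_bounded_above]) (auto simp: V_def S_def)
  then have "real (card J) \<le> real (card (V \<times> S) * 2 ^ ((n + 1) div 2))"
    by (rule of_nat_mono)
  also have "\<dots> = (2 * real n + 1) * (2 * (real n + \<bar>of_int m\<bar>) + 4) * 2 ^ ((n + 1) div 2)"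
    by (simp add: V_def S_def R_def card_cartesian_product nat_add_distrib algebra_simps)
  also have "\<dots> \<le> (2 * real n + 1) * (2 * (real n + \<bar>of_int m\<bar>) + 5) * 2 ^ ((n + 1) div 2)"
    by (intro mult_right_mono mult_left_mono) auto
  finally have card: "real (card J) \<le> (2 * real n + 1) * (2 * (real n + \<bar>of_int m\<bar>) + 5) * 2 ^ ((n + 1) div 2)" .
  have "x \<in> (\<Union>j\<in>J. dyadic n j)" if x: "x \<in> crossings f (of_int m) b" for x
  proof -
    have x01: "0 \<le> x" "x \<le> 1" "f x = of_int m * x + b" using x by (auto simp: crossings_def)
    obtain j where j: "j < 2^n" "x \<in> dyadic n j"
    proof (cases "x = 1")
      case True
      have "(2::nat)^n \<ge> 1" by simp
      then show ?thesis using True by (intro that[of "2^n - 1"]) (auto simp: dyadic_def of_nat_diff field_simps)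
    next
      case False
      define j where "j = nat \<lfloor>2^n * x\<rfloor>"
      have j: "real j \<le> 2^n * x" "2^n * x < real j + 1"
        unfolding j_def using x01 by (simp_all add: of_nat_nat)
      moreover have "2^n * x < 2^n" using False x01 by simp
      ultimately have "real j < 2^n" by linarith
      then have "j < 2^n" by (metis of_nat_less_iff of_nat_numeral of_nat_power)
      then show ?thesis using j by (intro that[of j]) (auto simp: dyadic_def field_simps)
    qed
    define u where "u = 2^n * x - real j"
    have u: "0 \<le> u" "u \<le> 1" using j(2) by (auto simp: u_def dyadic_def field_simps)
    have "\<bar>2^n * f x - of_int (offset (\<lambda>n _. c n) n j) - of_int (?s j) * u\<bar> \<le> 2/3"
      unfolding u_def using affine_approx[OF \<omega> _ j, of "\<lambda>n _. c n"] c(2) by auto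
    moreover have "2^n * f x = of_int m * (u + real j) + 2^n * b"
      by (simp add: x01 u_def algebra_simps)
    ultimately have "\<bar>2^n * b - of_int (?v j) - of_int (?s j - m) * u\<bar> \<le> 2/3"
      by (simp add: algebra_simps)
    moreover have "\<bar>of_int (?s j - m) * u\<bar> \<le> of_int (int n + \<bar>m\<bar>)"
    proof -
      have "\<bar>?s j - m\<bar> \<le> int n + \<bar>m\<bar>" using slope_bound[of c n j, OF c(1)] by linarith
      then have "real_of_int \<bar>?s j - m\<bar> \<le> of_int (int n + \<bar>m\<bar>)" by (simp only: of_int_le_iff)
      then have "real_of_int \<bar>?s j - m\<bar> * u \<le> of_int (int n + \<bar>m\<bar>) * 1"
        using u by (intro mult_mono) auto
      then show ?thesis using u by (simp add: abs_mult)
    qed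
    ultimately have "?v j \<in> V" unfolding V_def R_def by (rule int_in_floor_window)
    moreover have "?s j \<in> S" unfolding S_def using slope_bound[of c n j, OF c(1)] by auto
    ultimately have "j \<in> J" using j unfolding J_def F_def by auto
    then show ?thesis using j by blast
  qed
  moreover have "finite J" unfolding J_def using finF by (auto simp: V_def S_def)
  ultimately show ?thesis unfolding covered_def using card by blast
qed

lemma T_c_dim_le:
  assumes "f \<in> T_c"
  shows "hausdorff_dim (crossings f (of_int m) b) \<le> ereal (1/2)"
proof (rule hausdorff_dim_le_covered)
  fix s \<epsilon> :: real and N :: nat assume s: "s > 1/2" and \<epsilon>: "\<epsilon> > 0"
  define M where "M = \<bar>real_of_int m\<bar>"
  define \<delta> where "\<delta> = s - 1/2"
  have "\<delta> > 0" using s by (simp add: \<delta>_def)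
  then have "(\<lambda>n. (2 * real n + 1) * (2 * (real n + M) + 5) * 2 / 2 powr (\<delta> * real n)) \<longlonglongrightarrow> 0"
    by real_asymp
  then have "\<forall>\<^sub>F n in sequentially. (2 * real n + 1) * (2 * (real n + M) + 5) * 2 / 2 powr (\<delta> * real n) < \<epsilon>"
    using \<epsilon> by (rule order_tendstoD)
  then obtain n where n: "n \<ge> N" "(2 * real n + 1) * (2 * (real n + M) + 5) * 2 / 2 powr (\<delta> * real n) < \<epsilon>"
    unfolding eventually_sequentially by (meson nle_le)
  have "(2::real) ^ ((n + 1) div 2) = 2 powr real ((n + 1) div 2)" by (simp add: powr_realpow)
  also have "\<dots> \<le> 2 powr (1 + real n / 2)"
  proof (rule powr_mono)
    have "2 * ((n + 1) div 2) \<le> n + 1" by simp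
    then have "2 * real ((n + 1) div 2) \<le> real n + 1" by linarith
    then show "real ((n + 1) div 2) \<le> 1 + real n / 2" by simp
  qed simp
  also have "\<dots> = 2 * 2 powr (s * real n) / 2 powr (\<delta> * real n)"
    by (simp add: \<delta>_def powr_add powr_diff algebra_simps)
  finally have "(2 * real n + 1) * (2 * (real n + M) + 5) * 2 ^ ((n + 1) div 2)
      \<le> (2 * real n + 1) * (2 * (real n + M) + 5) * (2 * 2 powr (s * real n) / 2 powr (\<delta> * real n))"
    by (intro mult_left_mono) (auto simp: M_def)
  also have "\<dots> = ((2 * real n + 1) * (2 * (real n + M) + 5) * 2 / 2 powr (\<delta> * real n)) * 2 powr (s * real n)"
    by simp
  also have "\<dots> \<le> \<epsilon> * 2 powr (s * real n)"
    using n(2) by (intro mult_right_mono) auto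
  finally have "covered n (\<epsilon> * 2 powr (s * real n)) (crossings f (of_int m) b)"
    using covered_mono[OF T_c_covered[OF assms, of n m b]] unfolding M_def by blast
  then show "\<exists>n\<ge>N. covered n (\<epsilon> * 2 powr (s * real n)) (crossings f (of_int m) b)"
    using n(1) by blast
qed simp


section \<open>Constant signs: a level set of dimension one half\<close>

text \<open>
  At even levels the mass sits on flat pieces. Both halves of a flat piece have slope \<open>\<plusminus>1\<close>, and exactly
  one half of each of these is flat again; so mass is split equally at even levels and passed on undivided
  at odd levels.
\<close>

fun flat_mass :: "(nat \<Rightarrow> int) \<Rightarrow> nat \<Rightarrow> nat \<Rightarrow> real" where
  "flat_mass c 0 j = (if j = 0 then 1 else 0)"
| "flat_mass c (Suc n) j =
    (if even n then flat_mass c n (j div 2) / 2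
     else if slope (\<lambda>n _. c n) (Suc n) j = 0 then flat_mass c n (j div 2) else 0)"

lemma flat_mass_nonneg: "0 \<le> flat_mass c n j"
  by (induction n arbitrary: j) auto

lemma flat_mass_slope:
  assumes c: "\<And>n. c n = 1 \<or> c n = (-1::int)" and "flat_mass c n j > 0"
  shows "if even n then slope (\<lambda>n _. c n) n j = 0 else \<bar>slope (\<lambda>n _. c n) n j\<bar> = 1"
  using assms(2)
proof (induction n arbitrary: j)
  case (Suc n)
  show ?case
  proof (cases "even n")
    case True
    then show ?thesis using Suc.IH[of "j div 2"] Suc.prems c[of n] by (auto simp: abs_if)
  next
    case False
    then show ?thesis using Suc.prems by (auto split: if_splits)
  qed
qed simp

lemma dyadic_mass_flat:
  assumes c: "\<And>n. c n = 1 \<or> c n = (-1::int)"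
  shows "dyadic_mass (flat_mass c)"
proof
  fix n j
  show "flat_mass c n j = flat_mass c (Suc n) (2 * j) + flat_mass c (Suc n) (2 * j + 1)"
  proof (cases "even n \<or> flat_mass c n j = 0")
    case False
    then have "flat_mass c n j > 0" using flat_mass_nonneg[of c n j] by linarith
    then have "\<bar>slope (\<lambda>n _. c n) n j\<bar> = 1" using flat_mass_slope[of c, OF c] False by auto
    then show ?thesis using c[of n] False by (auto simp: abs_if split: if_splits)
  qed auto
qed (auto simp: flat_mass_nonneg)

lemma flat_mass_le: "flat_mass c n j \<le> (1/2^n) powr (1/2)"
proof -
  have "flat_mass c n j \<le> (1/2) ^ ((n + 1) div 2)"
  proof (induction n arbitrary: j)
    case (Suc n)
    show ?case using Suc[of "j div 2"] by (auto elim!: evenE oddE)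
  qed simp
  also have "\<dots> = (1/2) powr real ((n + 1) div 2)" by (simp add: powr_realpow)
  also have "\<dots> \<le> (1/2) powr (real n / 2)"
  proof (rule powr_mono')
    have "n \<le> 2 * ((n + 1) div 2)" by simp
    then have "real n \<le> 2 * real ((n + 1) div 2)" by linarith
    then show "real n / 2 \<le> real ((n + 1) div 2)" by simp
  qed auto
  also have "\<dots> = ((1/2) powr real n) powr (1/2)" by (simp add: powr_powr)
  also have "(1/2::real) powr real n = 1/2^n" by (simp add: powr_realpow power_divide)
  finally show ?thesis .
qed

text \<open>
  The graph over a flat piece is symmetric about its centre, so the two flat pieces that descend from it
  lie at the same height. All flat pieces carrying mass therefore approximate one common value.
\<close>

lemma flat_mass_offset:
  assumes c: "\<And>n. c n = 1 \<or> c n = (-1::int)"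
  shows "\<exists>V. \<forall>j. flat_mass c (2 * k) j > 0 \<longrightarrow> offset (\<lambda>n _. c n) (2 * k) j = V"
proof (induction k)
  case 0
  then show ?case by simp
next
  case (Suc k)
  then obtain V where V: "\<And>j. flat_mass c (2 * k) j > 0 \<Longrightarrow> offset (\<lambda>n _. c n) (2 * k) j = V" by blast
  \<comment> \<open>A grandchild is flat if it is an outer quarter and the two signs differ, or an inner quarter and
    they agree; in both cases its height is the same expression in the signs.\<close>
  have "offset (\<lambda>n _. c n) (2 * Suc k) j = 4 * V + c (2 * k) + c (Suc (2 * k))"
    if pos: "flat_mass c (2 * Suc k) j > 0" for j
  proof -
    define h where "h = j div 2"
    have s: "slope (\<lambda>n _. c n) (Suc (Suc (2 * k))) j = 0" and h: "flat_mass c (2 * k) (h div 2) > 0"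
      using pos by (auto simp: h_def split: if_splits)
    have "slope (\<lambda>n _. c n) (2 * k) (h div 2) = 0" using flat_mass_slope[of c, OF c h] by simp
    then show ?thesis
      using s V[OF h] by (auto simp: h_def[symmetric] split: if_splits)
  qed
  then show ?case by blast
qed

lemma T_c_level_set_dim_ge:
  assumes "f \<in> T_c"
  shows "\<exists>b. ereal (1/2) \<le> hausdorff_dim (crossings f 0 b)"
proof -
  obtain \<omega> c where \<omega>: "admissible_signs \<omega>" "takagi_expansion \<omega> f"
    and c: "\<And>n. c n = 1 \<or> c n = (-1::int)" "\<And>n j. j < 2^n \<Longrightarrow> real_of_int (c n) = \<omega> n (real j / 2^n)"
    using T_c_signs[OF assms] by metis
  interpret dyadic_mass "flat_mass c" using c(1) by (rule dyadic_mass_flat)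
  have dim: "ereal (1/2) \<le> hausdorff_dim support"
    by (rule hausdorff_dim_support_ge[where C = 1]) (use flat_mass_le in auto)
  then have "support \<noteq> {}" by (auto simp: zero_ereal_def)
  then obtain x where x: "x \<in> support" by blast
  have same: "f y = f x" if y: "y \<in> support" for y
  proof (rule ccontr)
    assume "f y \<noteq> f x"
    then have "\<bar>f y - f x\<bar> / 2 > 0" by simp
    then have "\<exists>k. (1/4)^k < \<bar>f y - f x\<bar> / 2" by (rule real_arch_pow_inv) simp
    then obtain k where k: "(1/4)^k < \<bar>f y - f x\<bar> / 2" ..
    obtain V where V: "\<And>j. flat_mass c (2 * k) j > 0 \<Longrightarrow> offset (\<lambda>n _. c n) (2 * k) j = V"
      using flat_mass_offset[of c k, OF c(1)] by blast
    have "\<bar>2^(2*k) * f z - of_int V\<bar> \<le> 2/3" if z: "z \<in> support" for z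
    proof -
      obtain j where j: "j < 2^(2*k)" "flat_mass c (2*k) j > 0" "z \<in> dyadic (2*k) j"
        using z by (rule supportE)
      have "slope (\<lambda>n _. c n) (2*k) j = 0" using flat_mass_slope[of c "2*k" j, OF c(1) j(2)] by simp
      moreover have "\<bar>2^(2*k) * f z - of_int (offset (\<lambda>n _. c n) (2*k) j)
          - of_int (slope (\<lambda>n _. c n) (2*k) j) * (2^(2*k) * z - real j)\<bar> \<le> 2/3"
        using c(2) by (rule affine_approx[OF \<omega> _ j(1,3)])
      ultimately show ?thesis by (simp only: V[OF j(2)] of_int_0 mult_zero_left diff_zero)
    qed
    from this[OF x] this[OF y] have "\<bar>2^(2*k) * f y - 2^(2*k) * f x\<bar> \<le> 4/3" by linarith
    then have "2^(2*k) * \<bar>f y - f x\<bar> \<le> 4/3"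
      unfolding right_diff_distrib[symmetric] abs_mult by simp
    moreover have "2^(2*k) * ((1/4)^k :: real) = 1" by (simp add: power_mult power_divide)
    then have "2^(2*k) * (\<bar>f y - f x\<bar> / 2) > 1"
      using k by (metis mult_less_cancel_left_pos zero_less_numeral zero_less_power)
    ultimately show False by simp
  qed
  have "support \<subseteq> crossings f 0 (f x)"
  proof
    fix y assume y: "y \<in> support"
    obtain j where "j < 2^0" "y \<in> dyadic 0 j" using y by (rule supportE)
    then show "y \<in> crossings f 0 (f x)" using same[OF y] by (auto simp: crossings_def dyadic_def)
  qed
  then have "hausdorff_dim support \<le> hausdorff_dim (crossings f 0 (f x))"
    by (intro hausdorff_dim_lipschitz_image[where g = id and L = 1]) auto
  then show ?thesis using dim order_trans by blast
qed

text \<open>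
  Passing to the left half changes the slope by the sign \<open>w\<close>, passing to the right half by \<open>- w\<close>; so
  one of the two halves brings the slope closer to zero.
\<close>

lemma T_c_dim_ge:
  assumes "f \<in> T_c"
  shows "\<exists>b. ereal (1/2) \<le> hausdorff_dim (crossings f (of_int m) b)"
  using assms
proof (induction "nat \<bar>m\<bar>" arbitrary: m f)
  case 0
  then show ?case using T_c_level_set_dim_ge by simp
next
  case (Suc k)
  obtain w gL gR where g: "w = 1 \<or> w = (-1::int)" "gL \<in> T_c" "gR \<in> T_c"
    "\<And>u. f (u / 2) = (of_int w * u + gL u) / 2"
    "\<And>u. f ((u + 1) / 2) = (of_int w * (1 - u) + gR u) / 2"
    using T_c_split[OF Suc.prems] by metis
  show ?case
  proof (cases "m > 0 \<longleftrightarrow> w = 1")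
    case True
    then have "k = nat \<bar>m - w\<bar>" using Suc.hyps(2) g(1) by auto
    then obtain b where "ereal (1/2) \<le> hausdorff_dim (crossings gL (of_int (m - w)) b)"
      using Suc.hyps(1) g(2) by blast
    then show ?thesis
      using hausdorff_dim_crossings_left[OF g(4), of "of_int m" b] order_trans by (metis of_int_diff)
  next
    case False
    then have "k = nat \<bar>m + w\<bar>" using Suc.hyps(2) g(1) by auto
    then obtain b where "ereal (1/2) \<le> hausdorff_dim (crossings gR (of_int (m + w)) b)"
      using Suc.hyps(1) g(3) by blast
    then show ?thesis
      using hausdorff_dim_crossings_right[OF g(5), of "of_int m" b] order_trans by (metis of_int_add)
  qed
qed

lemma is_max_attained:
  fixes d :: "'b \<Rightarrow> 'a::linorder"
  assumes le: "\<And>x. x \<in> X \<Longrightarrow> d x \<le> v" and ge: "\<exists>x\<in>X. v \<le> d x"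
  shows "is_max (d ` X) v"
proof -
  obtain x where x: "x \<in> X" "v \<le> d x" using ge by blast
  then have "d x = v" using le[OF x(1)] by (intro antisym)
  then show ?thesis unfolding is_max_def using le x(1) by blast
qed

section \<open>Weights of pieces\<close>

definition \<nu> :: real where "\<nu> = 4 powr d_v_star"

lemma nu_square: "\<nu>^2 = (9 + sqrt 105) / 2"
proof -
  have "\<nu>^2 = 16 powr d_v_star"
    unfolding \<nu>_def power2_eq_square by (simp flip: powr_mult)
  also have "\<dots> = exp (ln ((9 + sqrt 105) / 2))"
    by (simp add: powr_def d_v_star_def)
  also have "\<dots> = (9 + sqrt 105) / 2"
    by (intro exp_ln) (simp add: add_pos_nonneg)
  finally show ?thesis .
qed

lemma nu_pos: "\<nu> > 0" by (simp add: \<nu>_def)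

lemma nu_eq: "\<nu>^2 * \<nu>^2 = 9 * \<nu>^2 + 6"
  unfolding nu_square by (simp add: field_simps)

lemma nu_bounds: "31021/10000 < \<nu>" "\<nu> < 31022/10000"
proof -
  have "(102465/10000)^2 < (sqrt 105)^2" "(sqrt 105)^2 < (102471/10000)^2"
    by (simp_all add: power_divide)
  then have s: "102465/10000 < sqrt 105" "sqrt 105 < 102471/10000"
    using power2_less_imp_less[of "102465/10000" "sqrt 105"] power2_less_imp_less[of "sqrt 105" "102471/10000"] by auto
  show "31021/10000 < \<nu>"
    by (rule power2_less_imp_less[of _ \<nu>]) (use s nu_pos in \<open>auto simp: nu_square power_divide\<close>)
  show "\<nu> < 31022/10000"
    by (rule power2_less_imp_less[of \<nu>]) (use s nu_pos in \<open>auto simp: nu_square power_divide\<close>)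
qed

text \<open>
  Components of the eigenvector described below, normalised by the value \<open>1\<close> at the flat piece of
  height \<open>2/17\<close>. The equation \<open>\<nu>\<^sup>4 = 9 \<nu>\<^sup>2 + 6\<close> enters through \<open>pA_pC\<close> only.
\<close>

definition pA :: real where "pA = 3 / \<nu>"
definition pB :: real where "pB = 3 / \<nu>^2"
definition pC :: real where "pC = (3/2 + pB) / \<nu>"

lemma nu_pA: "\<nu> * pA = 3" using nu_pos by (simp add: pA_def)
lemma nu_pB: "\<nu> * pB = pA" using nu_pos by (simp add: pA_def pB_def power2_eq_square)
lemma nu_pC: "\<nu> * pC = 3/2 + pB" using nu_pos by (simp add: pC_def)
lemma pA_pC: "pA + pC = \<nu> / 2"
proof -
  have "\<nu> * (pA + pC) = 9/2 + pB"
    unfolding distrib_left nu_pA nu_pC by simp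
  then have "2 * \<nu>^2 * (\<nu> * (pA + pC)) = 9 * \<nu>^2 + 6"
    using nu_pos by (simp add: pB_def field_simps)
  also have "\<dots> = 2 * \<nu>^2 * (\<nu> * (\<nu> / 2))" unfolding nu_eq[symmetric] by (simp add: power2_eq_square)
  finally show ?thesis using nu_pos by simp
qed
lemma pA_bounds: "9670/10000 < pA" "pA < 9671/10000"
  using nu_bounds nu_pos by (auto simp: pA_def field_simps)
lemma pB_bounds: "3117/10000 < pB" "pB < 3118/10000"
proof -
  have "31021/10000 * \<nu> < \<nu>^2" "\<nu>^2 < 31022/10000 * \<nu>"
    using nu_bounds nu_pos by (simp_all add: power2_eq_square)
  then have "962302/100000 < \<nu>^2" "\<nu>^2 < 962365/100000" using nu_bounds by linarith+
  then show "3117/10000 < pB" "pB < 3118/10000" using nu_pos by (auto simp: pB_def field_simps)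
qed
lemma pC_bounds: "5839/10000 < pC" "pC < 5841/10000"
  using pA_pC pA_bounds nu_bounds by linarith+

text \<open>
  A piece is described by the slope \<open>m\<close> of the line relative to it and by the relative height \<open>x\<close> of the line
  at the centre of the piece. The functions below are weights for \<open>m = 0\<close>, for \<open>\<bar>m\<bar> = 2\<close> and for
  \<open>\<bar>m\<bar> \<ge> 4\<close>; they vanish where the line cannot meet the piece, namely beyond \<open>2/3\<close>, beyond \<open>7/6\<close> and
  beyond \<open>\<bar>m\<bar>/2 + 1/24\<close>. Two halvings act on heights by maps \<open>x \<mapsto> 4 * x - k\<close> with integer \<open>k\<close>, and all break
  points are carried to these end points, up to sign, by finitely many such maps.

  The cells of \<open>2/17\<close> and \<open>8/17\<close> in \<open>flat_weight\<close> and those of \<open>9/17\<close>, \<open>15/17\<close> and \<open>19/17\<close> in \<open>tilted_weight\<close>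
  contain the pieces of the extremal configuration. Their values \<open>1\<close>, \<open>pA\<close> and \<open>pC\<close>, \<open>1/2\<close>, \<open>pB\<close> are the Perron eigenvector of
  that configuration, and there the inequalities below hold with equality for the extremal signs. The decimal values on the
  remaining cells solve the other inequalities with some slack.
\<close>

definition flat_weight :: "real \<Rightarrow> real" where
  "flat_weight x = (if \<bar>x\<bar> < 5/48 then 9675/10000 else if \<bar>x\<bar> \<le> 5/12 then 1 else if \<bar>x\<bar> \<le> 23/48 then pA
    else if \<bar>x\<bar> \<le> 2/3 then 936/1000 else 0)"

definition tilted_weight :: "real \<Rightarrow> real" where
  "tilted_weight x = (if \<bar>x\<bar> \<le> 49/96 then 6137/10000 else if \<bar>x\<bar> \<le> 13/24 then pC else if \<bar>x\<bar> \<le> 85/96 then 1/2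
    else if \<bar>x\<bar> \<le> 47/48 then 484/1000 else if \<bar>x\<bar> \<le> 97/96 then 468/1000 else if \<bar>x\<bar> \<le> 25/24 then 43/100
    else if \<bar>x\<bar> \<le> 53/48 then 325/1000 else if \<bar>x\<bar> \<le> 7/6 then pB else 0)"

definition steep_weight :: "nat \<Rightarrow> real \<Rightarrow> real" where
  "steep_weight m x = (if \<bar>x\<bar> \<le> real m / 2 + 1/24 then 24/100 else 0)"

lemma flat_weight_minus [simp]: "flat_weight (- x) = flat_weight x" by (simp add: flat_weight_def)
lemma tilted_weight_minus [simp]: "tilted_weight (- x) = tilted_weight x" by (simp add: tilted_weight_def)
lemma steep_weight_minus [simp]: "steep_weight m (- x) = steep_weight m x" by (simp add: steep_weight_def)

lemma flat_weight_nonneg: "0 \<le> flat_weight x" and flat_weight_le_1: "flat_weight x \<le> 1"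
  and flat_weight_small: "\<bar>x\<bar> < 5/48 \<Longrightarrow> flat_weight x \<le> 9675/10000"
  and flat_weight_gt_5_12: "5/12 < \<bar>x\<bar> \<Longrightarrow> flat_weight x \<le> pA"
  and flat_weight_gt_23_48: "23/48 < \<bar>x\<bar> \<Longrightarrow> flat_weight x \<le> 936/1000"
  and flat_weight_dead: "2/3 < \<bar>x\<bar> \<Longrightarrow> flat_weight x = 0"
  using pA_bounds by (auto simp: flat_weight_def)

lemma tilted_weight_nonneg: "0 \<le> tilted_weight x" and tilted_weight_le: "tilted_weight x \<le> 6137/10000"
  and tilted_weight_gt_49_96: "49/96 < \<bar>x\<bar> \<Longrightarrow> tilted_weight x \<le> pC"
  and tilted_weight_gt_13_24: "13/24 < \<bar>x\<bar> \<Longrightarrow> tilted_weight x \<le> 1/2"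
  and tilted_weight_gt_85_96: "85/96 < \<bar>x\<bar> \<Longrightarrow> tilted_weight x \<le> 484/1000"
  and tilted_weight_gt_47_48: "47/48 < \<bar>x\<bar> \<Longrightarrow> tilted_weight x \<le> 468/1000"
  and tilted_weight_gt_97_96: "97/96 < \<bar>x\<bar> \<Longrightarrow> tilted_weight x \<le> 43/100"
  and tilted_weight_gt_25_24: "25/24 < \<bar>x\<bar> \<Longrightarrow> tilted_weight x \<le> 325/1000"
  and tilted_weight_gt_53_48: "53/48 < \<bar>x\<bar> \<Longrightarrow> tilted_weight x \<le> pB"
  and tilted_weight_dead: "7/6 < \<bar>x\<bar> \<Longrightarrow> tilted_weight x = 0"
  using pB_bounds pC_bounds by (auto simp: tilted_weight_def)

lemma steep_weight_nonneg: "0 \<le> steep_weight m x" and steep_weight_le: "steep_weight m x \<le> 24/100"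
  and steep_weight_dead: "real m / 2 + 1/24 < \<bar>x\<bar> \<Longrightarrow> steep_weight m x = 0"
  by (auto simp: steep_weight_def)

lemma flat_tilted_weight_le_3_2: "\<bar>z\<bar> \<le> 5/12 \<Longrightarrow> flat_weight z + tilted_weight (1 - z) \<le> 3/2"
proof -
  assume "\<bar>z\<bar> \<le> 5/12"
  then have "tilted_weight (1 - z) \<le> 1/2" by (intro tilted_weight_gt_13_24) linarith
  then show ?thesis using flat_weight_le_1[of z] by linarith
qed

text \<open>
  The two pieces that arise from one half of a flat piece: a flat one, and one of slope two that shares an
  end point with it.
\<close>

lemma flat_tilted_weight_le: "flat_weight z + tilted_weight (1 - z) \<le> \<nu> / 2"
proof -
  consider "\<bar>z\<bar> \<le> 5/12" | "5/12 < \<bar>z\<bar>" "\<bar>z\<bar> \<le> 23/48" | "23/48 < \<bar>z\<bar>" by linarith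
  then show ?thesis
  proof cases
    case 1
    then show ?thesis using flat_tilted_weight_le_3_2[of z] nu_bounds by linarith
  next
    case 2
    then have "flat_weight z \<le> pA" "tilted_weight (1 - z) \<le> pC"
      by (auto intro!: flat_weight_gt_5_12 tilted_weight_gt_49_96)
    then show ?thesis using pA_pC by linarith
  next
    case 3
    then show ?thesis using flat_weight_gt_23_48[of z] tilted_weight_le[of "1 - z"] nu_bounds by linarith
  qed
qed

text \<open>
  The two halves of a flat piece are mirror images of each other, so each of them may use
  half of the factor \<open>\<nu>\<close>; the two inequalities correspond to the sign on that half.
\<close>

lemma flat_weight_step:
  shows "flat_weight (4 * x) + tilted_weight (4 * x - 1) \<le> \<nu> / 2 * flat_weight x" (is ?A)
    and "tilted_weight (4 * x - 1) + flat_weight (4 * x - 2) \<le> \<nu> / 2 * flat_weight x" (is ?B)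
proof -
  have S: "tilted_weight (4 * x - 1) = tilted_weight (1 - 4 * x)" using tilted_weight_minus[of "1 - 4 * x"] by simp
  have S': "tilted_weight (4 * x - 1) = tilted_weight (1 - (2 - 4 * x))" "flat_weight (4 * x - 2) = flat_weight (2 - 4 * x)"
    using flat_weight_minus[of "2 - 4 * x"] by simp_all
  consider "\<bar>x\<bar> < 5/48" | "5/48 \<le> \<bar>x\<bar>" "\<bar>x\<bar> \<le> 5/12" | "5/12 < x" "x \<le> 23/48" | "23/48 < x" "x \<le> 2/3"
    | "2/3 < x" | "x < - 5/12" by linarith
  then have "?A \<and> ?B"
  proof cases
    case 1
    then have w: "flat_weight x = 9675/10000" by (simp add: flat_weight_def)
    have "flat_weight (4 * x) + tilted_weight (4 * x - 1) \<le> 3/2"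
      unfolding S by (rule flat_tilted_weight_le_3_2) (use 1 in linarith)
    moreover have "flat_weight (4 * x - 2) = 0" by (rule flat_weight_dead) (use 1 in linarith)
    moreover have "tilted_weight (4 * x - 1) \<le> 6137/10000" by (rule tilted_weight_le)
    ultimately show ?thesis unfolding w using nu_bounds by linarith
  next
    case 2
    then have w: "flat_weight x = 1" by (simp add: flat_weight_def)
    show ?thesis unfolding w using flat_tilted_weight_le[of "4 * x"] flat_tilted_weight_le[of "2 - 4 * x"] S S' by linarith
  next
    case 3
    then have w: "flat_weight x = pA" by (simp add: flat_weight_def)
    have "flat_weight (4 * x) = 0" by (rule flat_weight_dead) (use 3 in linarith)
    moreover have "tilted_weight (4 * x - 1) \<le> 1/2" by (rule tilted_weight_gt_13_24) (use 3 in linarith)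
    moreover have "tilted_weight (4 * x - 1) + flat_weight (4 * x - 2) \<le> 3/2"
      using flat_tilted_weight_le_3_2[of "2 - 4 * x"] S' 3 by linarith
    ultimately show ?thesis unfolding w using nu_pA by simp
  next
    case 4
    then have w: "flat_weight x = 936/1000" by (simp add: flat_weight_def)
    have A: "flat_weight (4 * x) = 0" by (rule flat_weight_dead) (use 4 in linarith)
    have B: "tilted_weight (4 * x - 1) \<le> 484/1000" by (rule tilted_weight_gt_85_96) (use 4 in linarith)
    have "tilted_weight (4 * x - 1) + flat_weight (4 * x - 2) \<le> 14515/10000"
    proof (cases "4 * x - 2 < 5/48")
      case True
      then have "flat_weight (4 * x - 2) \<le> 9675/10000" by (intro flat_weight_small) (use 4 in linarith)
      then show ?thesis using B by linarith
    next
      case False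
      then have "tilted_weight (4 * x - 1) \<le> 325/1000" by (intro tilted_weight_gt_25_24) linarith
      then show ?thesis using flat_weight_le_1[of "4 * x - 2"] by linarith
    qed
    then show ?thesis unfolding w using A B nu_bounds by linarith
  next
    case 5
    have "flat_weight (4 * x) = 0" by (rule flat_weight_dead) (use 5 in linarith)
    moreover have "tilted_weight (4 * x - 1) = 0" by (rule tilted_weight_dead) (use 5 in linarith)
    moreover have "flat_weight (4 * x - 2) = 0" by (rule flat_weight_dead) (use 5 in linarith)
    ultimately show ?thesis using flat_weight_nonneg[of x] nu_pos by simp
  next
    case 6
    have "flat_weight (4 * x) = 0" by (rule flat_weight_dead) (use 6 in linarith)
    moreover have "tilted_weight (4 * x - 1) = 0" by (rule tilted_weight_dead) (use 6 in linarith)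
    moreover have "flat_weight (4 * x - 2) = 0" by (rule flat_weight_dead) (use 6 in linarith)
    ultimately show ?thesis using flat_weight_nonneg[of x] nu_pos by simp
  qed
  then show ?A ?B by auto
qed

text \<open>
  The four pieces obtained from one of slope two by two halvings, the first with sign \<open>1\<close>. The signs on the
  two halves account for the alternatives in \<open>A\<close> and \<open>C\<close>. Few of the pieces are met by the line at the same
  time, so that the cases follow the cells of \<open>tilted_weight\<close>; only for \<open>11/24 \<le> x \<le> 13/24\<close>
  do the weights of three pieces have to be balanced against each other.
\<close>

lemma tilted_weight_step:
  assumes A: "A = flat_weight (4 * x - 4) \<or> A = flat_weight (4 * x - 2)"
    and C: "C = tilted_weight (4 * x - 1) + steep_weight 4 (4 * x + 2) \<or> C = steep_weight 4 (4 * x) + tilted_weight (4 * x + 3)"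
  shows "A + tilted_weight (4 * x - 3) + C \<le> \<nu> * tilted_weight x"
proof -
  let ?B = "tilted_weight (4 * x - 3)"
  have A1: "A \<le> 1" using A flat_weight_le_1 by auto
  have A_left: "A \<le> flat_weight (4 * x - 2)" if "x < 5/6"
    using A flat_weight_dead[of "4 * x - 4"] flat_weight_nonneg[of "4 * x - 2"] that by auto
  have A_right: "A \<le> flat_weight (4 * x - 4)" if "2/3 < x"
    using A flat_weight_dead[of "4 * x - 2"] flat_weight_nonneg[of "4 * x - 4"] that by auto
  have A0: "A = 0" if "x < 1/3 \<or> 7/6 < x"
    using A flat_weight_dead[of "4 * x - 4"] flat_weight_dead[of "4 * x - 2"] that by auto
  have B0: "?B = 0" if "x < 11/24 \<or> 25/24 < x"
    by (rule tilted_weight_dead) (use that in linarith)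
  have C1: "C \<le> 8537/10000"
    using C tilted_weight_le[of "4 * x - 1"] tilted_weight_le[of "4 * x + 3"] steep_weight_le[of 4 "4 * x + 2"] steep_weight_le[of 4 "4 * x"] by auto
  have C2: "C = tilted_weight (4 * x - 1) \<or> C = steep_weight 4 (4 * x)" if "1/96 < x"
    using C steep_weight_dead[of 4 "4 * x + 2"] tilted_weight_dead[of "4 * x + 3"] that by auto
  have C3: "C \<le> tilted_weight (4 * x - 1)" if "49/96 < x"
    using C2 steep_weight_dead[of 4 "4 * x"] tilted_weight_nonneg[of "4 * x - 1"] that by auto
  have C0: "C = 0" if "13/24 < x \<or> x < - 7/6"
    using C steep_weight_dead[of 4 "4 * x"] steep_weight_dead[of 4 "4 * x + 2"] tilted_weight_dead[of "4 * x - 1"] tilted_weight_dead[of "4 * x + 3"] that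
    by auto
  consider "x < - 7/6 \<or> 7/6 < x" | "- 7/6 \<le> x" "x < 1/3" | "1/3 \<le> x" "x < 11/24" | "11/24 \<le> x" "x \<le> 49/96"
    | "49/96 < x" "x \<le> 13/24" | "13/24 < x" "x \<le> 85/96" | "85/96 < x" "x \<le> 47/48" | "47/48 < x" "x \<le> 97/96"
    | "97/96 < x" "x \<le> 25/24" | "25/24 < x" "x \<le> 53/48" | "53/48 < x" "x \<le> 7/6" by linarith
  then show ?thesis
  proof cases
    case 1
    then have "A = 0" "?B = 0" "C = 0" using A0 B0 C0 by auto
    then show ?thesis using tilted_weight_nonneg[of x] nu_pos by simp
  next
    case 2
    then have "A = 0" "?B = 0" using A0 B0 by auto
    moreover have "pB \<le> tilted_weight x" using 2 pB_bounds pC_bounds by (auto simp: tilted_weight_def)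
    then have "pA \<le> \<nu> * tilted_weight x" using nu_pos unfolding nu_pB[symmetric] by simp
    ultimately show ?thesis using C1 pA_bounds by linarith
  next
    case 3
    then have w: "tilted_weight x = 6137/10000" and "?B = 0" using B0 by (auto simp: tilted_weight_def)
    moreover have "C \<le> 6137/10000" using C2 3 tilted_weight_le[of "4 * x - 1"] steep_weight_le[of 4 "4 * x"] by auto
    ultimately show ?thesis unfolding w using A1 nu_bounds by linarith
  next
    \<comment> \<open>The slope two pieces are centred at \<open>4 * x - 3\<close> and \<open>4 * x - 1\<close>, near \<open>- 1\<close> and \<open>1\<close>, and the flat one
      at their mean: the closer one centre is to zero, the farther the other one is.\<close>
    case 4
    then have w: "tilted_weight x = 6137/10000" by (auto simp: tilted_weight_def)
    have B: "?B \<le> 484/1000" by (rule tilted_weight_gt_85_96) (use 4 in linarith)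
    have "C = tilted_weight (4 * x - 1) \<or> C = steep_weight 4 (4 * x)" using C2 4 by auto
    then have "A + ?B + C \<le> 19035/10000"
    proof
      assume "C = steep_weight 4 (4 * x)"
      then show ?thesis using A1 B steep_weight_le[of 4 "4 * x"] by linarith
    next
      assume C: "C = tilted_weight (4 * x - 1)"
      have A: "A \<le> 9675/10000" if "43/48 < 4 * x - 1"
      proof -
        have "flat_weight (4 * x - 2) \<le> 9675/10000" by (rule flat_weight_small) (use that 4 in linarith)
        then show ?thesis using A_left 4 by linarith
      qed
      consider "4 * x - 1 \<le> 85/96" | "85/96 < 4 * x - 1" "4 * x - 1 \<le> 43/48" | "43/48 < 4 * x - 1" "4 * x - 1 \<le> 47/48"
        | "47/48 < 4 * x - 1" "4 * x - 1 \<le> 97/96" | "97/96 < 4 * x - 1" by linarith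
      then show ?thesis
      proof cases
        case 1
        have "C \<le> 1/2" unfolding C by (rule tilted_weight_gt_13_24) (use 4 in linarith)
        moreover have "?B \<le> pB" by (rule tilted_weight_gt_53_48) (use 1 in linarith)
        ultimately show ?thesis using A1 pB_bounds by linarith
      next
        case 2
        have "C \<le> 484/1000" unfolding C by (rule tilted_weight_gt_85_96) (use 2 in linarith)
        moreover have "?B \<le> 325/1000" by (rule tilted_weight_gt_25_24) (use 2 in linarith)
        ultimately show ?thesis using A1 by linarith
      next
        case 3
        have "C \<le> 484/1000" unfolding C by (rule tilted_weight_gt_85_96) (use 3 in linarith)
        moreover have "?B \<le> 43/100" by (rule tilted_weight_gt_97_96) (use 3 in linarith)
        ultimately show ?thesis using A 3 by linarith
      next
        case 4
        have "C \<le> 468/1000" unfolding C by (rule tilted_weight_gt_47_48) (use 4 in linarith)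
        moreover have "?B \<le> 468/1000" by (rule tilted_weight_gt_47_48) (use 4 in linarith)
        ultimately show ?thesis using A 4 by linarith
      next
        case 5
        have "C \<le> 43/100" unfolding C by (rule tilted_weight_gt_97_96) (use 5 in linarith)
        then show ?thesis using A B 5 by linarith
      qed
    qed
    then show ?thesis unfolding w using nu_bounds by linarith
  next
    case 5
    then have w: "tilted_weight x = pC" by (auto simp: tilted_weight_def)
    have C: "C \<le> tilted_weight (4 * x - 1)" using C3 5 by auto
    have "A + ?B + C \<le> 3/2 + pB"
    proof (cases "4 * x - 1 \<le> 53/48")
      case True
      have "tilted_weight (4 * x - 1) \<le> 325/1000" by (rule tilted_weight_gt_25_24) (use 5 in linarith)
      moreover have "?B \<le> 484/1000" by (rule tilted_weight_gt_85_96) (use True in linarith)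
      ultimately show ?thesis using A1 C pB_bounds by linarith
    next
      case False
      have "tilted_weight (4 * x - 1) \<le> pB" by (rule tilted_weight_gt_53_48) (use False in linarith)
      moreover have "?B \<le> 1/2" by (rule tilted_weight_gt_13_24) (use 5 in linarith)
      ultimately show ?thesis using A1 C by linarith
    qed
    then show ?thesis unfolding w nu_pC .
  next
    case 6
    then have w: "tilted_weight x = 1/2" and "C = 0" using C0 by (auto simp: tilted_weight_def)
    moreover have "A + ?B \<le> \<nu> / 2"
    proof (cases "x < 5/6")
      case True
      have "?B = tilted_weight (1 - (4 * x - 2))" using tilted_weight_minus[of "4 * x - 3"] by simp
      then show ?thesis using A_left[OF True] flat_tilted_weight_le[of "4 * x - 2"] by linarith
    next
      case False
      have "flat_weight (4 * x - 4) = flat_weight (4 - 4 * x)" using flat_weight_minus[of "4 * x - 4"] by simp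
      then show ?thesis using A_right False flat_tilted_weight_le[of "4 - 4 * x"] by simp
    qed
    ultimately show ?thesis unfolding w by simp
  next
    case 7
    then have w: "tilted_weight x = 484/1000" and C: "C = 0" using C0 by (auto simp: tilted_weight_def)
    have A: "A \<le> flat_weight (4 - 4 * x)" using A_right 7 flat_weight_minus[of "4 * x - 4"] by simp
    have "A + ?B \<le> 3/2"
    proof (cases "4 - 4 * x \<le> 5/12")
      case True
      then show ?thesis using A flat_tilted_weight_le_3_2[of "4 - 4 * x"] 7 by simp
    next
      case False
      have "flat_weight (4 - 4 * x) \<le> pA" by (rule flat_weight_gt_5_12) (use False in linarith)
      moreover have "?B \<le> 1/2" by (rule tilted_weight_gt_13_24) (use 7 in linarith)
      ultimately show ?thesis using A pA_bounds by linarith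
    qed
    then show ?thesis unfolding w C using nu_bounds by linarith
  next
    case 8
    then have w: "tilted_weight x = 468/1000" and C: "C = 0" using C0 by (auto simp: tilted_weight_def)
    have "flat_weight (4 * x - 4) \<le> 9675/10000" by (rule flat_weight_small) (use 8 in linarith)
    moreover have "?B \<le> 484/1000" by (rule tilted_weight_gt_85_96) (use 8 in linarith)
    ultimately show ?thesis unfolding w C using A_right 8 nu_bounds by linarith
  next
    case 9
    then have w: "tilted_weight x = 43/100" and C: "C = 0" using C0 by (auto simp: tilted_weight_def)
    have "?B \<le> 325/1000" by (rule tilted_weight_gt_25_24) (use 9 in linarith)
    then show ?thesis unfolding w C using A1 nu_bounds by linarith
  next
    case 10
    then have w: "tilted_weight x = 325/1000" and "C = 0" "?B = 0" using B0 C0 by (auto simp: tilted_weight_def)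
    then show ?thesis unfolding w using A1 nu_bounds by linarith
  next
    case 11
    then have w: "tilted_weight x = pB" and "C = 0" "?B = 0" using B0 C0 by (auto simp: tilted_weight_def)
    moreover have "flat_weight (4 * x - 4) \<le> pA" by (rule flat_weight_gt_5_12) (use 11 in linarith)
    ultimately show ?thesis using A_right 11 by (simp add: nu_pB)
  qed
qed

section \<open>Two halvings multiply the total weight by at most \<open>\<nu>\<close>\<close>

definition weight :: "int \<Rightarrow> real \<Rightarrow> real" where
  "weight m x = (if m = 0 then flat_weight x else if \<bar>m\<bar> = 2 then tilted_weight x else steep_weight (nat \<bar>m\<bar>) x)"

lemma weight_minus_slope [simp]: "weight (- m) x = weight m x" and weight_minus [simp]: "weight m (- x) = weight m x"
  by (simp_all add: weight_def)

lemma weight_nonneg: "0 \<le> weight m x"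
  using flat_weight_nonneg tilted_weight_nonneg steep_weight_nonneg by (simp add: weight_def)

text \<open>
  Steep pieces. Here \<open>e i\<close> are the relative heights of the line at the end points of the four pieces. They
  increase by at least two, whereas a piece is met only if the line is at most \<open>1/6\<close> above zero at its left
  end and at most \<open>1/6\<close> below zero at its right end. So at most two pieces count; if there are two, they are
  neighbours and the line passes near their common end point, where the weight of slope two is at
  most \<open>1/2\<close>.
\<close>

lemma weight_steep_step:
  fixes e :: "nat \<Rightarrow> real" and \<sigma> :: "nat \<Rightarrow> int"
  assumes e: "\<And>i. i < 4 \<Longrightarrow> e (Suc i) = e i + of_int (\<sigma> i)"
    and \<sigma>: "\<And>i. i < 4 \<Longrightarrow> 2 \<le> \<sigma> i" "4 \<le> \<sigma> 0 \<or> 4 \<le> \<sigma> 1" "4 \<le> \<sigma> 2" "4 \<le> \<sigma> 3"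
  shows "(\<Sum>i<4. weight (\<sigma> i) ((e i + e (Suc i)) / 2)) \<le> 744/1000"
    and "1/6 < e 0 \<or> e 4 < - 1/6 \<Longrightarrow> (\<Sum>i<4. weight (\<sigma> i) ((e i + e (Suc i)) / 2)) = 0"
proof -
  define W where "W i = weight (\<sigma> i) ((e i + e (Suc i)) / 2)" for i
  have dead: "W i = 0" if "i < 4" "1/6 < e i \<or> e (Suc i) < - 1/6" for i
  proof -
    have "of_int (\<sigma> i) / 2 + 1/6 < \<bar>(e i + e (Suc i)) / 2\<bar>"
      using that(2) e[OF that(1)] by auto
    then show ?thesis
      using \<sigma>(1)[OF that(1)] unfolding W_def weight_def by (auto intro!: tilted_weight_dead steep_weight_dead)
  qed
  have le: "W i \<le> 6137/10000" if "i < 4" for i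
    using \<sigma>(1)[OF that] tilted_weight_le order_trans[OF steep_weight_le, of "6137/10000"] unfolding W_def weight_def by auto
  have steep: "W i \<le> 24/100" if "4 \<le> \<sigma> i" for i
    using that steep_weight_le unfolding W_def weight_def by auto
  have near: "W i \<le> 1/2" if i: "i < 4" and "\<bar>e i\<bar> \<le> 1/6 \<or> \<bar>e (Suc i)\<bar> \<le> 1/6" for i
  proof (cases "4 \<le> \<sigma> i")
    case True
    then show ?thesis using steep[of i] by linarith
  next
    case False
    have "of_int (\<sigma> i) \<ge> (2::real)" using \<sigma>(1)[OF i] by simp
    moreover have "13/24 < \<bar>(a + (a + s)) / 2\<bar>" if "2 \<le> s" "\<bar>a\<bar> \<le> 1/6 \<or> \<bar>a + s\<bar> \<le> 1/6" for a s :: real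
      using that by argo
    ultimately have "13/24 < \<bar>(e i + e (Suc i)) / 2\<bar>" using that(2) unfolding e[OF i] by blast
    moreover have "W i \<le> tilted_weight ((e i + e (Suc i)) / 2) \<or> W i \<le> 24/100"
      using \<sigma>(1)[OF i] steep_weight_le unfolding W_def weight_def by auto
    ultimately show ?thesis using tilted_weight_gt_13_24[of "(e i + e (Suc i)) / 2"] by linarith
  qed
  have sum: "(\<Sum>i<4. W i) = W 0 + W 1 + W 2 + W 3"
  proof -
    have "{..<4} = {0, 1, 2, 3::nat}" by auto
    then show ?thesis by simp
  qed
  have "e 1 = e 0 + of_int (\<sigma> 0)" "e 2 = e 1 + of_int (\<sigma> 1)" "e 3 = e 2 + of_int (\<sigma> 2)" "e 4 = e 3 + of_int (\<sigma> 3)"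
    using e[of 0] e[of 1] e[of 2] e[of 3] by (simp_all add: eval_nat_numeral)
  moreover have "of_int (\<sigma> 0) \<ge> (2::real)" "of_int (\<sigma> 1) \<ge> (2::real)" "of_int (\<sigma> 2) \<ge> (2::real)" "of_int (\<sigma> 3) \<ge> (2::real)"
    using \<sigma>(1) by simp_all
  ultimately have inc: "e 1 \<ge> e 0 + 2" "e 2 \<ge> e 1 + 2" "e 3 \<ge> e 2 + 2" "e 4 \<ge> e 3 + 2" by linarith+
  have d: "e 0 > 1/6 \<or> e 1 < -1/6 \<Longrightarrow> W 0 = 0" "e 1 > 1/6 \<or> e 2 < -1/6 \<Longrightarrow> W 1 = 0"
    "e 2 > 1/6 \<or> e 3 < -1/6 \<Longrightarrow> W 2 = 0" "e 3 > 1/6 \<or> e 4 < -1/6 \<Longrightarrow> W 3 = 0"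
    using dead[of 0] dead[of 1] dead[of 2] dead[of 3] by (simp_all add: eval_nat_numeral)
  have n1: "\<bar>e 1\<bar> \<le> 1/6 \<Longrightarrow> W 0 \<le> 1/2 \<and> W 1 \<le> 1/2" using near[of 0] near[of 1] by (simp add: eval_nat_numeral)
  have n2: "\<bar>e 2\<bar> \<le> 1/6 \<Longrightarrow> W 1 \<le> 1/2" using near[of 1] by (simp add: eval_nat_numeral)
  have l: "W 0 \<le> 6137/10000" "W 1 \<le> 6137/10000" using le by auto
  have q: "W 2 \<le> 24/100" "W 3 \<le> 24/100" "W 0 \<le> 24/100 \<or> W 1 \<le> 24/100"
    using steep \<sigma> by auto
  show "(\<Sum>i<4. weight (\<sigma> i) ((e i + e (Suc i)) / 2)) \<le> 744/1000"
    unfolding W_def[symmetric] sum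
  proof -
    consider "1/6 < e 1" | "\<bar>e 1\<bar> \<le> 1/6" | "e 1 < -1/6" "1/6 < e 2" | "e 1 < -1/6" "\<bar>e 2\<bar> \<le> 1/6" | "e 2 < -1/6"
      using inc by linarith
    then show "W 0 + W 1 + W 2 + W 3 \<le> 744/1000"
    proof cases
      case 1
      then have "W 1 = 0" "W 2 = 0" "W 3 = 0" using d inc by auto
      then show ?thesis using l by simp
    next
      case 2
      then have "1/6 < e 2" "1/6 < e 3" using inc by linarith+
      then have "W 2 = 0" "W 3 = 0" using d by auto
      then show ?thesis using q(3) n1[OF 2] by auto
    next
      case 3
      then have "1/6 < e 3" using inc by linarith
      then have "W 0 = 0" "W 2 = 0" "W 3 = 0" using d 3 by auto
      then show ?thesis using l by simp
    next
      case 4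
      then have "1/6 < e 3" using inc by linarith
      then have "W 0 = 0" "W 3 = 0" using d 4 by auto
      then show ?thesis using n2 4 q by simp
    next
      case 5
      then have "e 1 < -1/6" using inc by linarith
      then have "W 0 = 0" "W 1 = 0" using d 5 by auto
      then show ?thesis using q by simp
    qed
  qed
  show "(\<Sum>i<4. weight (\<sigma> i) ((e i + e (Suc i)) / 2)) = 0" if "1/6 < e 0 \<or> e 4 < - 1/6"
    unfolding W_def[symmetric] sum using that
  proof
    assume "1/6 < e 0"
    then have "1/6 < e 1" "1/6 < e 2" "1/6 < e 3" using inc by linarith+
    then show "W 0 + W 1 + W 2 + W 3 = 0" using d \<open>1/6 < e 0\<close> by simp
  next
    assume "e 4 < - 1/6"
    then have "e 1 < -1/6" "e 2 < -1/6" "e 3 < -1/6" using inc by linarith+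
    then show "W 0 + W 1 + W 2 + W 3 = 0" using d \<open>e 4 < - 1/6\<close> by simp
  qed
qed


lemma weight_step_aux:
  assumes m: "even m" "0 \<le> m" and l: "l = 1 \<or> l = -1" and r: "r = 1 \<or> r = (-1::int)"
  shows "weight (m - 1 - l) (4 * x - 3 * of_int m / 2 - 1/2 - of_int l / 2)
       + weight (m - 1 + l) (4 * x - of_int m / 2 - 3/2 - of_int l / 2)
       + weight (m + 1 - r) (4 * x + of_int m / 2 - 3/2 - of_int r / 2)
       + weight (m + 1 + r) (4 * x + 3 * of_int m / 2 - 1/2 - of_int r / 2) \<le> \<nu> * weight m x"
proof -
  obtain k where "m = 2 * k" using m(1) by (rule evenE)
  then have "m = 0 \<or> m = 2 \<or> 4 \<le> m" using m(2) by presburger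
  then consider "m = 0" | "m = 2" | "4 \<le> m" by blast
  then show ?thesis
  proof cases
    case 1
    have "flat_weight (4 * x) + tilted_weight (4 * x - 1) \<le> \<nu> / 2 * flat_weight x" "tilted_weight (4 * x - 1) + flat_weight (4 * x - 2) \<le> \<nu> / 2 * flat_weight x"
      by (rule flat_weight_step)+
    then show ?thesis using l r by (auto simp: weight_def 1)
  next
    case 2
    have left: "weight (m - 1 - l) (4 * x - 3 * of_int m / 2 - 1/2 - of_int l / 2) + weight (m - 1 + l) (4 * x - of_int m / 2 - 3/2 - of_int l / 2)
      = (if l = 1 then flat_weight (4 * x - 4) else flat_weight (4 * x - 2)) + tilted_weight (4 * x - 3)"
      using l by (auto simp: weight_def 2)
    have right: "weight (m + 1 - r) (4 * x + of_int m / 2 - 3/2 - of_int r / 2) + weight (m + 1 + r) (4 * x + 3 * of_int m / 2 - 1/2 - of_int r / 2)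
      = (if r = 1 then tilted_weight (4 * x - 1) + steep_weight 4 (4 * x + 2) else steep_weight 4 (4 * x) + tilted_weight (4 * x + 3))"
      using r by (auto simp: weight_def 2 add.commute)
    have w: "weight m x = tilted_weight x" by (simp add: weight_def 2)
    have "(if l = 1 then flat_weight (4 * x - 4) else flat_weight (4 * x - 2)) + tilted_weight (4 * x - 3)
        + (if r = 1 then tilted_weight (4 * x - 1) + steep_weight 4 (4 * x + 2) else steep_weight 4 (4 * x) + tilted_weight (4 * x + 3)) \<le> \<nu> * tilted_weight x"
      by (rule tilted_weight_step) auto
    then show ?thesis unfolding w left[symmetric] right[symmetric] add.assoc .
  next
    case 3
    define \<sigma> where "\<sigma> i = [m - 1 - l, m - 1 + l, m + 1 - r, m + 1 + r] ! i" for i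
    define e where "e i = 4 * x - 2 * of_int m + (\<Sum>k<i. real_of_int (\<sigma> k))" for i
    have e: "e (Suc i) = e i + of_int (\<sigma> i)" for i by (simp add: e_def)
    have \<sigma>: "2 \<le> \<sigma> i" if "i < 4" for i
    proof -
      have "i = 0 \<or> i = 1 \<or> i = 2 \<or> i = 3" using that by linarith
      then show ?thesis using l r 3 by (auto simp: \<sigma>_def)
    qed
    have \<sigma>4: "4 \<le> \<sigma> 0 \<or> 4 \<le> \<sigma> 1" "4 \<le> \<sigma> 2" "4 \<le> \<sigma> 3"
      using l r 3 by (auto simp: \<sigma>_def)
    note bound = weight_steep_step[of e \<sigma>, OF e \<sigma> \<sigma>4]
    have e1: "e 0 = 4 * x - 2 * of_int m" "e 1 = 4 * x - of_int m - 1 - of_int l" "e 2 = 4 * x - 2"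
      "e 3 = 4 * x + of_int m - 1 - of_int r" "e 4 = 4 * x + 2 * of_int m"
      by (simp_all add: e_def \<sigma>_def eval_nat_numeral)
    have mids: "(e 0 + e (Suc 0)) / 2 = 4 * x - 3 * of_int m / 2 - 1/2 - of_int l / 2"
      "(e 1 + e (Suc 1)) / 2 = 4 * x - of_int m / 2 - 3/2 - of_int l / 2"
      "(e 2 + e (Suc 2)) / 2 = 4 * x + of_int m / 2 - 3/2 - of_int r / 2"
      "(e 3 + e (Suc 3)) / 2 = 4 * x + 3 * of_int m / 2 - 1/2 - of_int r / 2"
      by (simp_all add: e_def \<sigma>_def eval_nat_numeral field_simps)
    have \<sigma>': "\<sigma> 0 = m - 1 - l" "\<sigma> 1 = m - 1 + l" "\<sigma> 2 = m + 1 - r" "\<sigma> 3 = m + 1 + r"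
      by (simp_all add: \<sigma>_def)
    have four: "(\<Sum>i<4. g i) = g 0 + g 1 + g 2 + g (3::nat)" for g :: "nat \<Rightarrow> real"
      by (simp add: eval_nat_numeral)
    have sum: "(\<Sum>i<4. weight (\<sigma> i) ((e i + e (Suc i)) / 2))
      = weight (m - 1 - l) (4 * x - 3 * of_int m / 2 - 1/2 - of_int l / 2)
       + weight (m - 1 + l) (4 * x - of_int m / 2 - 3/2 - of_int l / 2)
       + weight (m + 1 - r) (4 * x + of_int m / 2 - 3/2 - of_int r / 2)
       + weight (m + 1 + r) (4 * x + 3 * of_int m / 2 - 1/2 - of_int r / 2)"
      unfolding four mids \<sigma>' ..
    have w: "weight m x = (if \<bar>x\<bar> \<le> of_int m / 2 + 1/24 then 24/100 else 0)"
      using 3 by (simp add: weight_def steep_weight_def)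
    show ?thesis
    proof (cases "\<bar>x\<bar> \<le> of_int m / 2 + 1/24")
      case True
      then have w': "weight m x = 24/100" using w by simp
      show ?thesis unfolding sum[symmetric] w' using bound(1) nu_bounds by linarith
    next
      case False
      then have "1/6 < e 0 \<or> e 4 < - 1/6" unfolding e1 by linarith
      then show ?thesis unfolding sum[symmetric] using bound(2) w False by simp
    qed
  qed
qed

text \<open>
  The four summands are the pieces obtained by two halvings with sign \<open>w\<close> on the piece and signs \<open>l\<close> and \<open>r\<close> on
  its halves. Reflection in the vertical and in the horizontal axis reduces the claim to \<open>0 \<le> m\<close> and
  \<open>w = 1\<close>.
\<close>

lemma weight_step:
  assumes m: "even m" and w: "w = 1 \<or> w = (-1::int)" and l: "l = 1 \<or> l = (-1::int)" and r: "r = 1 \<or> r = (-1::int)"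
  shows "weight (m - w - l) (4 * x - 3 * of_int m / 2 - of_int w / 2 - of_int l / 2)
       + weight (m - w + l) (4 * x - of_int m / 2 - 3 * of_int w / 2 - of_int l / 2)
       + weight (m + w - r) (4 * x + of_int m / 2 - 3 * of_int w / 2 - of_int r / 2)
       + weight (m + w + r) (4 * x + 3 * of_int m / 2 - of_int w / 2 - of_int r / 2) \<le> \<nu> * weight m x"
    (is "?S m w l r x \<le> _")
proof -
  have mirror: "?S m w l r x = ?S (- m) w r l x" for m w l r x
    using weight_minus_slope[of "m - w - l"] weight_minus_slope[of "m - w + l"]
      weight_minus_slope[of "m + w - r"] weight_minus_slope[of "m + w + r"]
    by (simp add: algebra_simps)
  have neg: "?S m w l r x = ?S (- m) (- w) (- l) (- r) (- x)" for m w l r x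
  proof -
    have 1: "weight (- a) (- b) = weight a b" for a b by simp
    show ?thesis
      by (subst (1 2 3 4) 1[symmetric]) (simp add: algebra_simps del: weight_minus weight_minus_slope)
  qed
  have one: "?S m 1 l r x \<le> \<nu> * weight m x" if m: "even m" and l: "l = 1 \<or> l = -1" and r: "r = 1 \<or> r = (-1::int)" for m l r x
  proof (cases "0 \<le> m")
    case True
    then show ?thesis using weight_step_aux[OF m True l r, where x = x] by simp
  next
    case False
    then have "?S (- m) 1 r l x \<le> \<nu> * weight (- m) x" using weight_step_aux[where m = "- m" and l = r and r = l and x = x] m l r by simp
    then show ?thesis unfolding mirror[where m = m and w = 1 and l = l and r = r and x = x] by simp
  qed
  show ?thesis
  proof (cases "w = 1")
    case True
    then show ?thesis using one[OF m l r] by simp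
  next
    case False
    then have "w = -1" using w by simp
    moreover have "?S (- m) 1 (- l) (- r) (- x) \<le> \<nu> * weight (- m) (- x)"
      by (rule one) (use m l r in auto)
    ultimately show ?thesis unfolding neg[where m = m and w = w and l = l and r = r and x = x] by simp
  qed
qed


text \<open>
  The excess of the relative height over \<open>\<bar>m\<bar>/2\<close> tells by how much the line misses the chord of the graph.
  On a half where the line meets the graph the excess is at least twice as large, while \<open>\<bar>m\<bar>\<close> has dropped
  by at most one; after \<open>k\<close> such steps it is still bounded by \<open>2/3\<close>.
\<close>

lemma crossings_center_bound:
  assumes "f \<in> T_v" "int k \<le> \<bar>m\<bar>" "crossings f (of_int m) b \<noteq> {}"
  shows "\<bar>b + of_int m / 2\<bar> \<le> of_int \<bar>m\<bar> / 2 + (2/3) / 2^k"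
  using assms
proof (induction k arbitrary: f m b)
  case 0
  obtain u where u: "0 \<le> u" "u \<le> 1" "f u = of_int m * u + b"
    using 0(3) by (auto simp: crossings_def)
  have "\<bar>f u\<bar> \<le> 2/3"
    using 0(1) u(1,2) takagi_bound[of _ f u] unfolding T_v_def by auto
  moreover have "\<bar>of_int m * (u - 1/2)\<bar> \<le> of_int \<bar>m\<bar> * (1/2)"
  proof -
    have "\<bar>u - 1/2\<bar> \<le> 1/2" unfolding abs_le_iff using u(1,2) by simp
    then show ?thesis unfolding abs_mult of_int_abs by (intro mult_left_mono) auto
  qed
  moreover have "b + of_int m / 2 = f u - of_int m * (u - 1/2)" unfolding u(3) by (simp add: algebra_simps)
  ultimately show ?case by simp
next
  case (Suc k)
  obtain w gL gR where g: "w = 1 \<or> w = (-1::int)" "gL \<in> T_v" "gR \<in> T_v"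
    "\<And>u. f (u / 2) = (of_int w * u + gL u) / 2"
    "\<And>u. f ((u + 1) / 2) = (of_int w * (1 - u) + gR u) / 2"
    using T_v_split[OF Suc.prems(1)] by metis
  define E where "E = (2/3::real) / 2^k"
  have E: "E \<ge> 0" "(2/3::real) / 2^Suc k = E / 2" by (simp_all add: E_def)
  have w: "real_of_int w = 1 \<or> real_of_int w = -1" using g(1) by auto
  have "m \<ge> 1 \<or> m \<le> -1" using Suc.prems(2) by auto
  then have M: "1 \<le> real_of_int m \<or> real_of_int m \<le> -1" by auto
  have left: "\<bar>b + M / 2\<bar> \<le> \<bar>M\<bar> / 2 + E / 2"
    if "W = 1 \<or> W = -1" "1 \<le> M \<or> M \<le> -1" "0 \<le> E" "\<bar>2 * b + (M - W) / 2\<bar> \<le> \<bar>M - W\<bar> / 2 + E" for W M E :: real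
    using that by (elim disjE) (auto simp: abs_if field_simps split: if_splits)
  have right: "\<bar>b + M / 2\<bar> \<le> \<bar>M\<bar> / 2 + E / 2"
    if "W = 1 \<or> W = -1" "1 \<le> M \<or> M \<le> -1" "0 \<le> E" "\<bar>2 * b + M - W + (M + W) / 2\<bar> \<le> \<bar>M + W\<bar> / 2 + E" for W M E :: real
    using that by (elim disjE) (auto simp: abs_if field_simps split: if_splits)
  have k: "int k \<le> \<bar>m - w\<bar>" "int k \<le> \<bar>m + w\<bar>" using Suc.prems(2) g(1) by auto
  have "crossings gL (of_int (m - w)) (2 * b) \<noteq> {} \<or> crossings gR (of_int (m + w)) (2 * b + of_int m - of_int w) \<noteq> {}"
    using Suc.prems(3) crossings_split[OF g(4,5), of "of_int m" b] by auto
  then have "\<bar>b + of_int m / 2\<bar> \<le> of_int \<bar>m\<bar> / 2 + E / 2"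
  proof
    assume "crossings gL (of_int (m - w)) (2 * b) \<noteq> {}"
    then have "\<bar>2 * b + of_int (m - w) / 2\<bar> \<le> of_int \<bar>m - w\<bar> / 2 + E"
      unfolding E_def by (rule Suc.IH[OF g(2) k(1)])
    then show ?thesis using left[OF w M E(1)] by simp
  next
    assume "crossings gR (of_int (m + w)) (2 * b + of_int m - of_int w) \<noteq> {}"
    then have "\<bar>2 * b + of_int m - of_int w + of_int (m + w) / 2\<bar> \<le> of_int \<bar>m + w\<bar> / 2 + E"
      unfolding E_def by (rule Suc.IH[OF g(3) k(2)])
    then show ?thesis using right[OF w M E(1)] by simp
  qed
  then show ?case unfolding E(2) .
qed

text \<open>
  The weight is positive wherever the line can meet the piece, its smallest positive value being \<open>24/100\<close>.
\<close>

lemma weight_crossings: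
  assumes "f \<in> T_v" "even m" "crossings f (of_int m) b \<noteq> {}"
  shows "1 \<le> 5 * weight m (b + of_int m / 2)"
proof -
  have bound: "\<bar>b + of_int m / 2\<bar> \<le> of_int \<bar>m\<bar> / 2 + (2/3) / 2^k" if "int k \<le> \<bar>m\<bar>" for k
    by (rule crossings_center_bound[OF assms(1) that assms(3)])
  obtain k where "m = 2 * k" using assms(2) by (rule evenE)
  then have "m = 0 \<or> \<bar>m\<bar> = 2 \<or> 4 \<le> \<bar>m\<bar>" by presburger
  then consider "m = 0" | "\<bar>m\<bar> = 2" | "4 \<le> \<bar>m\<bar>" by blast
  then show ?thesis
  proof cases
    case 1
    then show ?thesis using bound[of 0] pA_bounds by (simp add: weight_def flat_weight_def)
  next
    case 2
    then have "\<bar>b + of_int m / 2\<bar> \<le> 7/6" using bound[of 2] by simp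
    moreover have "m \<noteq> 0" using 2 by auto
    ultimately show ?thesis using 2 pB_bounds pC_bounds by (simp add: weight_def tilted_weight_def)
  next
    case 3
    then have "\<bar>b + of_int m / 2\<bar> \<le> real (nat \<bar>m\<bar>) / 2 + 1/24" using bound[of 4] by simp
    moreover have "m \<noteq> 0" using 3 by auto
    ultimately show ?thesis using 3 by (simp add: weight_def steep_weight_def)
  qed
qed

section \<open>Variable signs: the upper bound\<close>

lemma T_v_covered_even:
  assumes "f \<in> T_v" "even m"
  shows "covered (2 * n) (5 * weight m (b + of_int m / 2) * \<nu>^n) (crossings f (of_int m) b)"
  using assms
proof (induction n arbitrary: f m b)
  case 0
  show ?case
  proof (cases "crossings f (of_int m) b = {}")
    case True
    then show ?thesis unfolding covered_def using weight_nonneg by (intro exI[of _ "{}"]) auto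
  next
    case False
    then show ?thesis
      unfolding covered_def using weight_crossings[OF 0 False]
      by (intro exI[of _ "{0}"]) (auto simp: dyadic_def crossings_def)
  qed
next
  case (Suc n)
  obtain w gL gR where g: "w = 1 \<or> w = (-1::int)" "gL \<in> T_v" "gR \<in> T_v"
    "\<And>u. f (u / 2) = (of_int w * u + gL u) / 2"
    "\<And>u. f ((u + 1) / 2) = (of_int w * (1 - u) + gR u) / 2"
    using T_v_split[OF Suc.prems(1)] by metis
  obtain l hL hR where h: "l = 1 \<or> l = (-1::int)" "hL \<in> T_v" "hR \<in> T_v"
    "\<And>u. gL (u / 2) = (of_int l * u + hL u) / 2"
    "\<And>u. gL ((u + 1) / 2) = (of_int l * (1 - u) + hR u) / 2"
    using T_v_split[OF g(2)] by metis
  obtain r kL kR where k: "r = 1 \<or> r = (-1::int)" "kL \<in> T_v" "kR \<in> T_v"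
    "\<And>u. gR (u / 2) = (of_int r * u + kL u) / 2"
    "\<And>u. gR ((u + 1) / 2) = (of_int r * (1 - u) + kR u) / 2"
    using T_v_split[OF g(3)] by metis
  define x where "x = b + of_int m / 2"
  define V where "V m x = 5 * \<nu>^n * weight m x" for m x
  have IH: "covered (2 * n) (V m' x') (crossings f' (of_int m') b')"
    if "f' \<in> T_v" "even m'" "x' = b' + of_int m' / 2" for f' m' b' x'
    using Suc.IH[OF that(1,2), of b'] unfolding V_def that(3) by (simp only: mult.assoc mult.commute[of "\<nu>^n"])
  have ev: "even (m - w - l)" "even (m - w + l)" "even (m + w - r)" "even (m + w + r)"
    using Suc.prems(2) g(1) h(1) k(1) by auto
  let ?v1 = "V (m - w - l) (4 * x - 3 * of_int m / 2 - of_int w / 2 - of_int l / 2)"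
  let ?v2 = "V (m - w + l) (4 * x - of_int m / 2 - 3 * of_int w / 2 - of_int l / 2)"
  let ?v3 = "V (m + w - r) (4 * x + of_int m / 2 - 3 * of_int w / 2 - of_int r / 2)"
  let ?v4 = "V (m + w + r) (4 * x + 3 * of_int m / 2 - of_int w / 2 - of_int r / 2)"
  have "covered (Suc (2 * n)) (?v1 + ?v2) (crossings gL (of_int (m - w)) (2 * b))"
    unfolding crossings_split[OF h(4,5)] of_int_diff[symmetric] of_int_add[symmetric]
    by (intro covered_halves IH h(2,3) ev(1,2)) (simp_all add: x_def field_simps)
  moreover have "covered (Suc (2 * n)) (?v3 + ?v4) (crossings gR (of_int (m + w)) (2 * b + of_int m - of_int w))"
    unfolding crossings_split[OF k(4,5)] of_int_diff[symmetric] of_int_add[symmetric]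
    by (intro covered_halves IH k(2,3) ev(3,4)) (simp_all add: x_def field_simps)
  ultimately have cov: "covered (2 * Suc n) ((?v1 + ?v2) + (?v3 + ?v4)) (crossings f (of_int m) b)"
    unfolding crossings_split[OF g(4,5)] mult_Suc_right add_2_eq_Suc
    by (intro covered_halves) simp_all
  have le: "(?v1 + ?v2) + (?v3 + ?v4) \<le> 5 * \<nu>^n * (\<nu> * weight m x)"
  proof -
    have "(?v1 + ?v2) + (?v3 + ?v4) = 5 * \<nu>^n *
      (weight (m - w - l) (4 * x - 3 * of_int m / 2 - of_int w / 2 - of_int l / 2)
       + weight (m - w + l) (4 * x - of_int m / 2 - 3 * of_int w / 2 - of_int l / 2)
       + weight (m + w - r) (4 * x + of_int m / 2 - 3 * of_int w / 2 - of_int r / 2)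
       + weight (m + w + r) (4 * x + 3 * of_int m / 2 - of_int w / 2 - of_int r / 2))"
      unfolding V_def by (simp only: distrib_left add.assoc)
    also have "\<dots> \<le> 5 * \<nu>^n * (\<nu> * weight m x)"
      using weight_step[OF Suc.prems(2) g(1) h(1) k(1)] nu_pos by (intro mult_left_mono) auto
    finally show ?thesis .
  qed
  have eq: "5 * \<nu>^n * (\<nu> * weight m x) = 5 * weight m (b + of_int m / 2) * \<nu>^Suc n"
    by (simp add: x_def)
  show ?case by (rule covered_mono[OF cov le[unfolded eq] order_refl])
qed

lemma weight_le_1: "weight m x \<le> 1"
  using flat_weight_le_1[of x] order_trans[OF tilted_weight_le[of x], of 1] order_trans[OF steep_weight_le[of "nat \<bar>m\<bar>" x], of 1] by (auto simp: weight_def)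

lemma T_v_covered:
  assumes "f \<in> T_v"
  shows "\<exists>i \<le> 1. \<forall>n. covered (2 * n + i) (10 * \<nu>^n) (crossings f (of_int m) b)"
proof (cases "even m")
  case True
  have "covered (2 * n) (10 * \<nu>^n) (crossings f (of_int m) b)" for n
    by (rule covered_mono[OF T_v_covered_even[OF assms True]])
      (use nu_pos weight_le_1[of m "b + of_int m / 2"] in \<open>auto intro!: mult_right_mono\<close>)
  then show ?thesis by (intro exI[of _ 0]) auto
next
  case False
  obtain w gL gR where g: "w = 1 \<or> w = (-1::int)" "gL \<in> T_v" "gR \<in> T_v"
    "\<And>u. f (u / 2) = (of_int w * u + gL u) / 2"
    "\<And>u. f ((u + 1) / 2) = (of_int w * (1 - u) + gR u) / 2"
    using T_v_split[OF assms] by metis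
  have ev: "even (m - w)" "even (m + w)" using False g(1) by auto
  have five: "covered (2 * n) (5 * \<nu>^n) (crossings h (of_int m') b')" if "h \<in> T_v" "even m'" for h m' b' n
    by (rule covered_mono[OF T_v_covered_even[OF that]])
      (use nu_pos weight_le_1[of m' "b' + of_int m' / 2"] in \<open>auto intro!: mult_right_mono\<close>)
  have "covered (Suc (2 * n)) (5 * \<nu>^n + 5 * \<nu>^n) (crossings f (of_int m) b)" for n
    unfolding crossings_split[OF g(4,5)] of_int_diff[symmetric] of_int_add[symmetric]
    by (intro covered_halves five g ev)
  then show ?thesis by (intro exI[of _ 1]) auto
qed

lemma nu_powr: "\<nu>^n = 2 powr (d_v_star * real (2 * n))"
proof -
  have "\<nu> = (2 powr 2) powr d_v_star" by (simp add: \<nu>_def)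
  then have "\<nu> = 2 powr (2 * d_v_star)" unfolding powr_powr .
  then have "\<nu> powr real n = (2 powr (2 * d_v_star)) powr real n" by simp
  then have "\<nu> powr real n = 2 powr (2 * d_v_star * real n)" unfolding powr_powr .
  then show ?thesis using nu_pos by (simp add: powr_realpow mult_ac)
qed

lemma d_v_star_pos: "0 < d_v_star"
proof -
  have "ln ((9 + sqrt 105) / 2) > 0" by (intro ln_gt_zero) (simp add: add_pos_nonneg less_le_trans[of 2 9])
  then show ?thesis by (simp add: d_v_star_def)
qed

lemma T_v_dim_le:
  assumes "f \<in> T_v"
  shows "hausdorff_dim (crossings f (of_int m) b) \<le> ereal d_v_star"
proof (rule hausdorff_dim_le_covered)
  fix s \<epsilon> :: real and N :: nat assume s: "s > d_v_star" and \<epsilon>: "\<epsilon> > 0"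
  obtain i where i: "i \<le> 1" "\<And>n. covered (2 * n + i) (10 * \<nu>^n) (crossings f (of_int m) b)"
    using T_v_covered[OF assms] by blast
  define \<delta> where "\<delta> = s - d_v_star"
  have "\<delta> > 0" using s by (simp add: \<delta>_def)
  then have "(\<lambda>n. 10 / 2 powr (\<delta> * real (2 * n))) \<longlonglongrightarrow> 0"
    by real_asymp
  then have "\<forall>\<^sub>F n in sequentially. 10 / 2 powr (\<delta> * real (2 * n)) < \<epsilon>"
    using \<epsilon> by (rule order_tendstoD)
  then obtain n where n: "n \<ge> N" "10 / 2 powr (\<delta> * real (2 * n)) < \<epsilon>"
    unfolding eventually_sequentially by (meson nle_le)
  have s0: "s > 0" using s d_v_star_pos by simp
  have "10 * \<nu>^n = (10 / 2 powr (\<delta> * real (2 * n))) * 2 powr (s * real (2 * n))"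
    unfolding nu_powr \<delta>_def by (simp add: powr_diff left_diff_distrib)
  also have "\<dots> \<le> \<epsilon> * 2 powr (s * real (2 * n))"
    using n(2) by (intro mult_right_mono) auto
  also have "\<dots> \<le> \<epsilon> * 2 powr (s * real (2 * n + i))"
    using \<epsilon> s0 by (intro mult_left_mono powr_mono) auto
  finally have "covered (2 * n + i) (\<epsilon> * 2 powr (s * real (2 * n + i))) (crossings f (of_int m) b)"
    using covered_mono[OF i(2)[of n]] by blast
  then show "\<exists>n\<ge>N. covered n (\<epsilon> * 2 powr (s * real n)) (crossings f (of_int m) b)"
    using n(1) by (intro exI[of _ "2 * n + i"]) auto
qed (use d_v_star_pos in simp)

section \<open>Variable signs: an extremal level set\<close>

lemma takagi_expansion_exists:
  assumes "admissible_signs \<omega>"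
  shows "\<exists>f. takagi_expansion \<omega> f"
proof -
  have "summable (\<lambda>n. \<omega> n x / 2^n * phi (2^n * x))" if x: "x \<in> {0..1}" for x
  proof (rule summable_comparison_test)
    have "norm (\<omega> n x / 2^n * phi (2^n * x)) \<le> (1/2)^n" for n
    proof -
      have "\<bar>\<omega> n x\<bar> = 1" using sign_cases[OF assms x, of n] by auto
      then show ?thesis
        using phi_le_half[of "2^n * x"] phi_nonneg[of "2^n * x"] by (simp add: abs_mult power_divide divide_simps)
    qed
    then show "\<exists>N. \<forall>n\<ge>N. norm (\<omega> n x / 2^n * phi (2^n * x)) \<le> (1/2)^n" by blast
  qed (simp add: summable_geometric)
  then have "takagi_expansion \<omega> (\<lambda>x. \<Sum>n. \<omega> n x / 2^n * phi (2^n * x))"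
    unfolding takagi_expansion_def by (blast intro: summable_sums)
  then show ?thesis by blast
qed

text \<open>
  The pair \<open>ends n j\<close> consists of the relative heights of the line \<open>y = 2/17\<close> at the end points of the piece
  \<open>j\<close> of level \<open>n\<close>, in units of \<open>1/17\<close>. The sign \<open>greedy\<close> lifts the midpoint of the graph unless
  the line passes below it, and lowers it in that case.
\<close>

definition greedy :: "int \<times> int \<Rightarrow> int" where
  "greedy p = (if 0 \<le> fst p + snd p then 1 else -1)"

fun ends :: "nat \<Rightarrow> nat \<Rightarrow> int \<times> int" where
  "ends 0 j = (2, 2)"
| "ends (Suc n) j =
    (let p = ends n (j div 2); d = fst p + snd p - 17 * greedy p
     in if even j then (2 * fst p, d) else (d, 2 * snd p))"

abbreviation greedy_sign :: "nat \<Rightarrow> nat \<Rightarrow> int" where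
  "greedy_sign n j \<equiv> greedy (ends n j)"

lemma ends_offset_slope:
  "ends n j = (2^(n+1) - 17 * offset greedy_sign n j,
    2^(n+1) - 17 * offset greedy_sign n j - 17 * slope greedy_sign n j)"
proof (induction n arbitrary: j)
  case (Suc n)
  let ?i = "j div 2"
  have "fst (ends n ?i) = 2^(n+1) - 17 * offset greedy_sign n ?i"
    "snd (ends n ?i) = 2^(n+1) - 17 * offset greedy_sign n ?i - 17 * slope greedy_sign n ?i"
    using Suc[of ?i] by simp_all
  then show ?case by (simp add: Let_def algebra_simps)
qed simp

lemma greedy_expansion:
  obtains \<omega> f where "admissible_signs \<omega>" "takagi_expansion \<omega> f"
    "\<And>n j. j < 2^n \<Longrightarrow> real_of_int (greedy_sign n j) = \<omega> n (real j / 2^n)"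
proof -
  define \<omega> where "\<omega> n x = real_of_int (greedy_sign n (nat \<lfloor>2^n * x\<rfloor>))" for n and x :: real
  have "admissible_signs \<omega>"
    unfolding admissible_signs_def
  proof (intro conjI allI ballI impI)
    fix n j :: nat
    have "\<omega> n x = real_of_int (greedy_sign n j)" if "x \<in> {real j / 2^n ..< (real j + 1) / 2^n}" for x
    proof -
      have "\<lfloor>2^n * x\<rfloor> = int j" using that by (intro floor_unique) (auto simp: field_simps)
      then show ?thesis by (simp add: \<omega>_def)
    qed
    then show "\<omega> n constant_on {real j / 2^n ..< (real j + 1) / 2^n}"
      unfolding constant_on_def by blast
  qed (simp add: \<omega>_def greedy_def)
  moreover obtain f where "takagi_expansion \<omega> f" using takagi_expansion_exists calculation by blast
  moreover have "real_of_int (greedy_sign n j) = \<omega> n (real j / 2^n)" for n j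
    by (simp add: \<omega>_def)
  ultimately show ?thesis using that by blast
qed

definition \<mu> :: real where "\<mu> = 2 powr d_v_star"

lemma mu_square: "\<mu> * \<mu> = \<nu>"
  by (simp add: \<mu>_def \<nu>_def flip: powr_mult)

lemma mu_pos: "0 < \<mu>" by (simp add: \<mu>_def)

lemma mu_le_2: "\<mu> \<le> 2"
proof (rule ccontr)
  assume "\<not> \<mu> \<le> 2"
  then have "2 * 2 \<le> \<mu> * \<mu>" by (intro mult_mono) auto
  then show False using nu_bounds by (simp add: mu_square)
qed

text \<open>
  A representative of a pair of end heights under reflection in the vertical axis, which exchanges
  them, and reflection in the horizontal axis, which negates both.
\<close>

definition normal :: "int \<times> int \<Rightarrow> int \<times> int" where
  "normal p = (let (b, c) = (if \<bar>fst p\<bar> \<le> \<bar>snd p\<bar> then p else (snd p, fst p)) in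
    if c < 0 then (- b, - c) else (b, c))"

text \<open>
  The nine kinds of pieces in the extremal configuration, and their weights. The flat pieces \<open>(2, 2)\<close> and
  \<open>(8, 8)\<close> and the pieces \<open>(-8, 26)\<close>, \<open>(-2, 32)\<close>, \<open>(2, 36)\<close> of slope two occur at even levels and have the
  weights \<open>weight\<close>; the others occur at odd levels. Four halvings turn \<open>(2, 2)\<close> into six copies each of
  \<open>(2, 2)\<close> and \<open>(-2, 32)\<close> and two of \<open>(2, 36)\<close>; half as many of each arise from \<open>(-2, 32)\<close>, and two copies each
  of \<open>(2, 2)\<close> and \<open>(-2, 32)\<close> from \<open>(2, 36)\<close>. The growth factor of this system is the larger root of
  \<open>\<lambda>\<^sup>2 = 9 \<lambda> + 6\<close>.
\<close>

definition share_list :: "((int \<times> int) \<times> real) list" where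
  "share_list = [((2, 2), 1), ((-2, 32), 1/2), ((2, 36), pB), ((-4, 13), \<mu> / 2), ((4, 21), \<mu> * pB),
    ((8, 8), pA), ((-8, 26), pC), ((-1, 16), \<mu> * pA / 2), ((1, 52), \<mu> * pB / \<nu>)]"

definition share :: "int \<times> int \<Rightarrow> real" where
  "share p = (case map_of share_list (normal p) of None \<Rightarrow> 0 | Some w \<Rightarrow> w)"

lemma share_eqs:
  "pA + pC = \<mu> * \<mu> / 2" "\<mu> * (\<mu> * pB) = pA" "pC = pA / 2 + pB / \<nu>" "\<mu> * (\<mu> * pA / 2) = 3/2" "\<mu> * (\<mu> * pB / \<nu>) = pB"
proof -
  have a: "\<mu> * (\<mu> * z) = \<nu> * z" for z by (simp add: mu_square flip: mult.assoc)
  show "pA + pC = \<mu> * \<mu> / 2" by (simp add: mu_square pA_pC)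
  show "\<mu> * (\<mu> * pB) = pA" using a[of pB] by (simp add: nu_pB)
  show "\<mu> * (\<mu> * pA / 2) = 3/2" using a[of "pA / 2"] nu_pA by simp
  show "\<mu> * (\<mu> * pB / \<nu>) = pB"
    using a[of "pB / \<nu>"] nu_pos by (simp only: times_divide_eq_right) simp
  show "pC = pA / 2 + pB / \<nu>" by (simp add: pC_def pA_def add_divide_distrib)
qed

lemma share_nonneg: "0 \<le> share p" and share_le: "share p \<le> 2"
proof -
  have "pA \<le> 1" "pB \<le> 1" "pC \<le> 1" "0 \<le> pA" "0 \<le> pB" "0 \<le> pC"
    using pA_bounds pB_bounds pC_bounds by auto
  moreover from this have "\<mu> * pB \<le> 2 * 1" "\<mu> * pA \<le> 2 * 1"
    using mu_pos mu_le_2 by (intro mult_mono; simp)+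
  moreover from this have "\<mu> * pB / \<nu> \<le> 2 * 1 / 1"
    using mu_pos nu_bounds by (intro frac_le) auto
  ultimately show "0 \<le> share p" "share p \<le> 2"
    using mu_pos mu_le_2 nu_pos by (auto simp: share_def share_list_def)
qed

lemma share_support:
  assumes "share (b, c) \<noteq> 0"
  obtains p q where "(p, q) \<in> {(2, 2), (-2, 32), (2, 36), (-4, 13), (4, 21), (8, 8), (-8, 26), (-1, 16), (1, 52)}"
    "(b, c) = (p, q) \<or> (b, c) = (q, p) \<or> (b, c) = (- p, - q) \<or> (b, c) = (- q, - p)"
proof -
  obtain p q where pq: "normal (b, c) = (p, q)" by fastforce
  have "(p, q) \<in> {(2, 2), (-2, 32), (2, 36), (-4, 13), (4, 21), (8, 8), (-8, 26), (-1, 16), (1, 52)}"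
    using assms unfolding share_def pq share_list_def by (auto split: if_splits)
  moreover have "(b, c) = (p, q) \<or> (b, c) = (q, p) \<or> (b, c) = (- p, - q) \<or> (b, c) = (- q, - p)"
    using pq unfolding normal_def by (auto simp: Let_def split: if_splits)
  ultimately show ?thesis by (rule that)
qed

lemma share_bound:
  assumes "share (b, c) \<noteq> 0"
  shows "\<bar>b\<bar> \<le> 52" "\<bar>c\<bar> \<le> 52"
  using assms by (auto elim!: share_support)

lemma normal_swap: "normal (c, b) = normal (b, c)"
  by (auto simp: normal_def)

lemma normal_minus: "normal (- b, - c) = normal (b, c)"
  by (auto simp: normal_def)

lemma share_swap: "share (c, b) = share (b, c)"
  by (simp add: share_def normal_swap)

lemma share_minus: "share (- b, - c) = share (b, c)"
  by (simp add: share_def normal_minus)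

lemma share_step_normal:
  assumes "(p, q) \<in> {(2, 2), (-2, 32), (2, 36), (-4, 13), (4, 21), (8, 8), (-8, 26), (-1, 16), (1, 52)}"
  shows "\<mu> * share (p, q) = share (2 * p, p + q - 17) + share (p + q - 17, 2 * q)"
proof -
  have v: "share (2, 2) = 1" "share (-2, -2) = 1" "share (-2, 32) = 1/2" "share (2, 36) = pB" "share (36, 104) = 0"
    "share (-4, 13) = \<mu> / 2" "share (4, -13) = \<mu> / 2" "share (-13, 4) = \<mu> / 2" "share (13, 64) = 0"
    "share (4, 21) = \<mu> * pB" "share (21, 72) = 0" "share (8, 8) = pA" "share (-8, -8) = pA" "share (8, 42) = 0"
    "share (-8, 26) = pC" "share (-1, 16) = \<mu> * pA / 2" "share (16, -1) = \<mu> * pA / 2" "share (-16, 1) = \<mu> * pA / 2"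
    "share (1, 52) = \<mu> * pB / \<nu>"
    by (simp_all add: share_def normal_def share_list_def)
  have C: "\<mu> * pC = \<mu> * pA / 2 + \<mu> * pB / \<nu>" unfolding share_eqs(3) by (simp add: distrib_left)
  from assms consider "p = 2" "q = 2" | "p = -2" "q = 32" | "p = 2" "q = 36" | "p = -4" "q = 13" | "p = 4" "q = 21"
    | "p = 8" "q = 8" | "p = -8" "q = 26" | "p = -1" "q = 16" | "p = 1" "q = 52" by auto
  then show ?thesis
  proof cases
    case 1 then show ?thesis by (simp add: v)
  next
    case 2 then show ?thesis by (simp add: v)
  next
    case 3 then show ?thesis by (simp add: v)
  next
    case 4 then show ?thesis using share_eqs(1) by (simp add: v)
  next
    case 5 then show ?thesis using share_eqs(2) by (simp add: v)
  next
    case 6 then show ?thesis by (simp add: v)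
  next
    case 7 then show ?thesis using C by (simp add: v)
  next
    case 8 then show ?thesis using share_eqs(4) by (simp add: v)
  next
    case 9 then show ?thesis using share_eqs(5) by (simp add: v)
  qed
qed

lemma share_step:
  assumes "share (b, c) \<noteq> 0"
  defines "d \<equiv> b + c - 17 * greedy (b, c)"
  shows "\<mu> * share (b, c) = share (2 * b, d) + share (d, 2 * c)"
proof -
  obtain p q where pq: "(p, q) \<in> {(2, 2), (-2, 32), (2, 36), (-4, 13), (4, 21), (8, 8), (-8, 26), (-1, 16), (1, 52)}"
    "(b, c) = (p, q) \<or> (b, c) = (q, p) \<or> (b, c) = (- p, - q) \<or> (b, c) = (- q, - p)"
    using assms(1) by (rule share_support)
  have pos: "0 < p + q" using pq(1) by auto
  define h where "h = p + q - 17"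
  note step = share_step_normal[OF pq(1), folded h_def]
  from pq(2) consider "b = p" "c = q" | "b = q" "c = p" | "b = - p" "c = - q" | "b = - q" "c = - p" by auto
  then show ?thesis
  proof cases
    case 1
    then have "d = h" using pos by (simp add: d_def h_def greedy_def)
    then show ?thesis using step 1 by simp
  next
    case 2
    then have "d = h" using pos by (simp add: d_def h_def greedy_def)
    then show ?thesis using step 2 share_swap[of p q] share_swap[of "2 * p" h] share_swap[of h "2 * q"] by simp
  next
    case 3
    then have "d = - h" using pos by (simp add: d_def h_def greedy_def)
    then show ?thesis using step 3 share_minus[of p q] share_minus[of "2 * p" h] share_minus[of h "2 * q"] by simp
  next
    case 4
    then have "d = - h" using pos by (simp add: d_def h_def greedy_def)
    then show ?thesis
      using step 4 share_minus[of q p] share_minus[of h "2 * p"] share_minus[of "2 * q" h]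
        share_swap[of p q] share_swap[of "2 * p" h] share_swap[of h "2 * q"] by simp
  qed
qed

text \<open>
  A piece outside the list gets no mass. Additivity then forces its descendants to have none either, even
  if they are on the list; this is why the recursion looks at the parent.
\<close>

fun greedy_mass :: "nat \<Rightarrow> nat \<Rightarrow> real" where
  "greedy_mass 0 j = (if j = 0 then 1 else 0)"
| "greedy_mass (Suc n) j = (if greedy_mass n (j div 2) = 0 then 0 else share (ends (Suc n) j) / \<mu>^Suc n)"

lemma share_start: "share (2, 2) = 1"
  by (simp add: share_def normal_def share_list_def)

lemma greedy_mass_eq: "greedy_mass n j \<noteq> 0 \<Longrightarrow> greedy_mass n j = share (ends n j) / \<mu>^n"
  by (cases n) (auto simp: share_start simp del: ends.simps(2) split: if_splits)

lemma dyadic_mass_greedy: "dyadic_mass greedy_mass"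
proof
  fix n j
  show "0 \<le> greedy_mass n j"
    using greedy_mass_eq[of n j] share_nonneg[of "ends n j"] mu_pos by (cases "greedy_mass n j = 0") auto
  show "greedy_mass n j = greedy_mass (Suc n) (2 * j) + greedy_mass (Suc n) (2 * j + 1)"
  proof (cases "greedy_mass n j = 0")
    case False
    obtain b c where bc: "ends n j = (b, c)" by fastforce
    have m: "greedy_mass n j = share (b, c) / \<mu>^n" using greedy_mass_eq[OF False] bc by simp
    then have "share (b, c) \<noteq> 0" using False by auto
    note step = share_step[OF this]
    have "greedy_mass (Suc n) (2 * j) + greedy_mass (Suc n) (2 * j + 1)
      = (share (2 * b, b + c - 17 * greedy (b, c)) + share (b + c - 17 * greedy (b, c), 2 * c)) / \<mu>^Suc n"
      using False by (simp add: bc Let_def add_divide_distrib)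
    also have "\<dots> = greedy_mass n j" unfolding step[symmetric] m using mu_pos by simp
    finally show ?thesis by (rule sym)
  qed simp
next
  show "greedy_mass 0 0 = 1" by simp
qed

lemma greedy_mass_le: "greedy_mass n j \<le> 2 * (1/2^n) powr d_v_star"
proof -
  have "(1/2^n) powr d_v_star = 1 / (2 powr real n) powr d_v_star"
    unfolding powr_realpow[of 2 n, symmetric, simplified] by (subst powr_divide) auto
  also have "(2 powr real n) powr d_v_star = \<mu> powr real n"
    unfolding \<mu>_def powr_powr by (simp add: mult.commute)
  also have "\<dots> = \<mu>^n" using mu_pos by (simp add: powr_realpow)
  finally have "(1/2^n) powr d_v_star = 1 / \<mu>^n" .
  moreover have "greedy_mass n j \<le> 2 / \<mu>^n"
    using greedy_mass_eq[of n j] share_le[of "ends n j"] mu_pos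
    by (cases "greedy_mass n j = 0") (auto intro!: divide_right_mono)
  ultimately show ?thesis by simp
qed

text \<open>
  On pieces that carry mass the relative heights of the line stay bounded, so the graph over such a
  piece of level \<open>n\<close> stays within a constant times \<open>2\<^sup>-\<^sup>n\<close> of the height \<open>2/17\<close>.
\<close>

lemma T_v_level_set_dim_ge: "\<exists>f\<in>T_v. \<exists>b. ereal d_v_star \<le> hausdorff_dim (crossings f 0 b)"
proof -
  obtain \<omega> f where \<omega>: "admissible_signs \<omega>" "takagi_expansion \<omega> f"
    and e: "\<And>n j. j < 2^n \<Longrightarrow> real_of_int (greedy_sign n j) = \<omega> n (real j / 2^n)"
    using greedy_expansion by metis
  interpret dyadic_mass greedy_mass by (rule dyadic_mass_greedy)
  have dim: "ereal d_v_star \<le> hausdorff_dim support"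
    by (rule hausdorff_dim_support_ge[OF greedy_mass_le d_v_star_pos])
  have close: "\<bar>f x - 2/17\<bar> \<le> 4 * (1/2)^n" if x: "x \<in> support" for x n
  proof -
    obtain j where j: "j < 2^n" "greedy_mass n j > 0" "x \<in> dyadic n j" using x by (rule supportE)
    obtain b c where bc: "ends n j = (b, c)" by fastforce
    have "share (b, c) \<noteq> 0" using greedy_mass_eq[of n j] j(2) bc by auto
    then have "\<bar>b\<bar> \<le> 52" "\<bar>c\<bar> \<le> 52" by (rule share_bound)+
    then have bc52: "\<bar>real_of_int b\<bar> \<le> 52" "\<bar>real_of_int c\<bar> \<le> 52" by linarith+
    define off where "off = real_of_int (offset greedy_sign n j)"
    define sl where "sl = real_of_int (slope greedy_sign n j)"
    have b: "real_of_int b = 2 * 2^n - 17 * off" "real_of_int c = 2 * 2^n - 17 * off - 17 * sl"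
      using ends_offset_slope[of n j] bc by (simp_all add: off_def sl_def)
    define u where "u = 2^n * x - real j"
    have u: "0 \<le> u" "u \<le> 1" using j(3) by (auto simp: u_def dyadic_def field_simps)
    have "\<bar>2^n * f x - off - sl * u\<bar> \<le> 2/3"
      unfolding off_def sl_def u_def by (rule affine_approx[OF \<omega> e j(1,3)])
    moreover have "off + sl * u = (2 * 2^n - ((1 - u) * b + u * c)) / 17"
      unfolding b by (simp add: field_simps)
    moreover have "\<bar>(1 - u) * b + u * c\<bar> \<le> 52"
    proof -
      have "\<bar>(1 - u) * b + u * c\<bar> \<le> (1 - u) * \<bar>b\<bar> + u * \<bar>c\<bar>"
        using u abs_triangle_ineq[of "(1 - u) * b" "u * c"] by (simp add: abs_mult)
      also have "\<dots> \<le> (1 - u) * 52 + u * 52"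
        using u bc52 by (intro add_mono mult_left_mono) auto
      finally show ?thesis by simp
    qed
    \<comment> \<open>\<open>52/17 + 2/3 \<le> 4\<close>\<close>
    ultimately have "\<bar>2^n * f x - 2^n * (2/17)\<bar> \<le> 4" by argo
    then have "2^n * \<bar>f x - 2/17\<bar> \<le> 4" unfolding right_diff_distrib[symmetric] abs_mult by simp
    then show ?thesis by (simp add: power_divide field_simps)
  qed
  have "support \<subseteq> crossings f 0 (2/17)"
  proof
    fix x assume x: "x \<in> support"
    obtain j where j: "j < 2^0" "x \<in> dyadic 0 j" using x by (rule supportE)
    have "(\<lambda>n. 4 * (1/2::real)^n) \<longlonglongrightarrow> 4 * 0" by (intro tendsto_intros) auto
    then have "\<bar>f x - 2/17\<bar> \<le> 0" using close[OF x] by (intro LIMSEQ_le_const[of "\<lambda>n. 4 * (1/2)^n"]) auto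
    then show "x \<in> crossings f 0 (2/17)" using j by (auto simp: crossings_def dyadic_def)
  qed
  then have "hausdorff_dim support \<le> hausdorff_dim (crossings f 0 (2/17))"
    by (intro hausdorff_dim_lipschitz_image[where g = id and L = 1]) auto
  moreover have "f \<in> T_v" using \<omega> unfolding T_v_def by blast
  ultimately show ?thesis using dim order_trans by blast
qed

text \<open>
  Planting an extremal function on the left half raises \<open>\<bar>m\<bar>\<close> by one, the sign being that of \<open>m\<close>.
\<close>

lemma T_v_dim_ge: "\<exists>f\<in>T_v. \<exists>b. ereal d_v_star \<le> hausdorff_dim (crossings f (of_int m) b)"
proof (induction "nat \<bar>m\<bar>" arbitrary: m)
  case 0
  then show ?case using T_v_level_set_dim_ge by simp
next
  case (Suc k)
  define w :: int where "w = (if 0 < m then 1 else -1)"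
  have "k = nat \<bar>m - w\<bar>" using Suc.hyps(2) by (auto simp: w_def)
  then obtain g b where g: "g \<in> T_v" "ereal d_v_star \<le> hausdorff_dim (crossings g (of_int (m - w)) b)"
    using Suc.hyps(1) by blast
  have "w = 1 \<or> w = -1" by (simp add: w_def)
  then obtain f where f: "f \<in> T_v" "\<And>u. u \<in> {0..1} \<Longrightarrow> f (u / 2) = (of_int w * u + g u) / 2"
    using T_v_join[OF g(1)] by metis
  have "hausdorff_dim (crossings g (of_int (m - w)) b) \<le> hausdorff_dim (crossings f (of_int m) (b / 2))"
    unfolding of_int_diff by (rule hausdorff_dim_crossings_left[OF f(2)])
  then show ?case using f(1) g(2) order_trans by blast
qed

section \<open>The maximal dimensions\<close>

theorem corollary1p4:
  shows "(\<forall>f\<in>T_c. \<forall>m::int.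
            is_max {hausdorff_dim (Graph f \<inter> line (of_int m) b) | b::real. True} (ereal (1/2)))
       \<and> (\<forall>m::int.
            is_max {hausdorff_dim (Graph f \<inter> line (of_int m) b) | f b. f \<in> T_v} (ereal d_v_star))"
proof (intro conjI ballI allI)
  fix f and m :: int assume f: "f \<in> T_c"
  have eq: "{hausdorff_dim (Graph f \<inter> line (of_int m) b) | b::real. True}
      = (\<lambda>b. hausdorff_dim (crossings f (of_int m) b)) ` UNIV"
    unfolding hausdorff_dim_graph_inter_line by auto
  show "is_max {hausdorff_dim (Graph f \<inter> line (of_int m) b) | b::real. True} (ereal (1/2))"
    unfolding eq using T_c_dim_le[OF f] T_c_dim_ge[OF f] by (intro is_max_attained) auto
next
  fix m :: int
  have eq: "{hausdorff_dim (Graph f \<inter> line (of_int m) b) | f b. f \<in> T_v}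
      = (\<lambda>(f, b). hausdorff_dim (crossings f (of_int m) b)) ` (T_v \<times> UNIV)"
    unfolding hausdorff_dim_graph_inter_line by auto
  show "is_max {hausdorff_dim (Graph f \<inter> line (of_int m) b) | f b. f \<in> T_v} (ereal d_v_star)"
    unfolding eq using T_v_dim_le T_v_dim_ge[of m] by (intro is_max_attained) auto
qed

end
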